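(* Let $T>0$ and let $\sigma$ be a real number. The estimate $$\|W_{b_1}[h]\|_{L^2_{xyt}(\mathbb{R}\times[0,1]\times[0,T])}\lesssim\|h\|_{H^\sigma_t([0,T];L^2_x(\mathbb{R}))\,\cap\, L^2_t([0,T];H^1_x(\mathbb{R}))},$$ with an implicit constant independent of $h\in H^\sigma_t([0,T];L^2_x(\mathbb{R}))\cap L^2_t([0,T];H^1_x(\mathbb{R}))$, holds only when $\sigma\ge\frac12$. That is, if there is a constant $C>0$ for which the estimate holds for all such $h$, then $\sigma\ge\frac12$.
   Context: The operator $W_{b_1}$ is defined by $$W_{b_1}[h](x,y,t)=\int_{-\infty}^\infty\sum_{n\in\mathbb{Z}}\left[n\int_0^t e^{-i\pi^2(\xi^2+n^2)(t-\tau)+i\pi(\xi x+ny)}\,\widehat{h^x}(\xi,\tau)\,d\tau\right]d\xi,$$ where $\widehat{h^x}(\xi,t)$ is the Fourier transform of $h(x,t)$ with respect to $x$, normalized so that $h(x,t)=\int_{-\infty}^\infty e^{i\pi x\xi}\,\widehat{h^x}(\xi,t)\,d\xi$. (Up to a constant factor, it is the solution operator of the linear Schrödinger equation $iu_t+u_{xx}+u_{yy}=0$ in $\mathbb{R}\times(0,1)$ with zero initial data, boundary data $h$ at $y=0$ and $0$ at $y=1$.) The norm of an intersection of spaces is the sum of the norms. $A\lesssim B$ means $A\le cB$ for some constant $c>0$. *)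

theory Defs
  imports "HOL-Analysis.Analysis"
begin

text \<open>Elements of \<open>L\<^sup>2(A)\<close> are represented by functions that are Borel measurable on \<open>A\<close>; every
  class of almost everywhere equal functions has such a representative.\<close>

definition L2_on :: "'a::euclidean_space set \<Rightarrow> ('a \<Rightarrow> complex) \<Rightarrow> bool" where
  "L2_on A f \<longleftrightarrow> set_borel_measurable lborel A f \<and> set_integrable lborel A (\<lambda>p. (cmod (f p))\<^sup>2)"

definition L2_norm_on :: "'a::euclidean_space set \<Rightarrow> ('a \<Rightarrow> complex) \<Rightarrow> real" where
  "L2_norm_on A f = sqrt (LINT p:A|lborel. (cmod (f p))\<^sup>2)"

text \<open>The limit is taken in \<open>[0,\<infinity>]\<close>, so that no convention about integrals of non-integrable
  functions enters.\<close>

definition L2_tendsto_on ::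
  "'a::euclidean_space set \<Rightarrow> (nat \<Rightarrow> 'a \<Rightarrow> complex) \<Rightarrow> ('a \<Rightarrow> complex) \<Rightarrow> bool" where
  "L2_tendsto_on A f u \<longleftrightarrow>
     (\<lambda>N. \<integral>\<^sup>+p\<in>A. ennreal ((cmod (f N p - u p))\<^sup>2) \<partial>lborel) \<longlonglongrightarrow> 0"

text \<open>The Fourier transform in \<open>x\<close>, normalized by
  \<open>h(x,t) = \<integral> exp(i\<pi>x\<xi>) g(\<xi>,t) d\<xi>\<close> with an absolutely convergent integral. This loses nothing for
  \<open>h(\<cdot>,t) \<in> H\<^sup>1(\<real>)\<close>, whose transform is integrable since
  \<open>(1+\<xi>\<^sup>2)\<^bsup>-1/2\<^esup>\<close> is in \<open>L\<^sup>2(\<real>)\<close>. Joint measurability of \<open>g\<close> is needed for the time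
  integral in \<open>W\<^bsub>b1\<^esub>\<close>. The transform is unique up to null sets, and every use below is independent
  of the representative.\<close>

definition is_fourier_x ::
  "real \<Rightarrow> (real \<times> real \<Rightarrow> complex) \<Rightarrow> (real \<times> real \<Rightarrow> complex) \<Rightarrow> bool" where
  "is_fourier_x T h g \<longleftrightarrow>
     set_borel_measurable lborel (UNIV \<times> {0..T}) g \<and>
     (AE t in lborel. t \<in> {0..T} \<longrightarrow>
        integrable lborel (\<lambda>\<xi>. g (\<xi>, t)) \<and>
        (AE x in lborel. h (x, t) =
           (LINT \<xi>|lborel. exp (\<i> * of_real (pi * x * \<xi>)) * g (\<xi>, t))))"

definition fourier_x :: "real \<Rightarrow> (real \<times> real \<Rightarrow> complex) \<Rightarrow> real \<times> real \<Rightarrow> complex" where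
  "fourier_x T h = (SOME g. is_fourier_x T h g)"

definition H1_weighted :: "(real \<times> real \<Rightarrow> complex) \<Rightarrow> real \<times> real \<Rightarrow> complex" where
  "H1_weighted g = (\<lambda>(\<xi>, t). of_real (sqrt (1 + \<xi>\<^sup>2)) * g (\<xi>, t))"

text \<open>\<open>L\<^sup>2\<^sub>t([0,T]; H\<^sup>1\<^sub>x(\<real>))\<close>.\<close>

definition in_L2t_H1x :: "real \<Rightarrow> (real \<times> real \<Rightarrow> complex) \<Rightarrow> bool" where
  "in_L2t_H1x T h \<longleftrightarrow>
     set_borel_measurable lborel (UNIV \<times> {0..T}) h \<and>
     (\<exists>g. is_fourier_x T h g \<and> L2_on (UNIV \<times> {0..T}) (H1_weighted g))"

definition L2t_H1x_norm :: "real \<Rightarrow> (real \<times> real \<Rightarrow> complex) \<Rightarrow> real" where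
  "L2t_H1x_norm T h = L2_norm_on (UNIV \<times> {0..T}) (H1_weighted (fourier_x T h))"

definition test_function :: "real \<Rightarrow> (real \<Rightarrow> complex) \<Rightarrow> bool" where
  "test_function T \<phi> \<longleftrightarrow>
     (\<exists>D. D 0 = \<phi> \<and> (\<forall>n t. (D n has_vector_derivative D (Suc n) t) (at t))) \<and>
     (\<exists>a b. 0 < a \<and> a \<le> b \<and> b < T \<and> (\<forall>t. t \<notin> {a..b} \<longrightarrow> \<phi> t = 0))"

definition Hs_weighted :: "real \<Rightarrow> (real \<times> real \<Rightarrow> complex) \<Rightarrow> real \<times> real \<Rightarrow> complex" where
  "Hs_weighted \<sigma> G = (\<lambda>(x, \<tau>). of_real ((1 + \<tau>\<^sup>2) powr (\<sigma> / 2)) * G (x, \<tau>))"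

text \<open>\<open>H\<^sup>\<sigma>\<^sub>t([0,T]; L\<^sup>2\<^sub>x(\<real>))\<close>, for any real \<open>\<sigma>\<close>, is the space of restrictions to \<open>(0,T)\<close> of elements of
  \<open>H\<^sup>\<sigma>(\<real>; L\<^sup>2\<^sub>x(\<real>))\<close>, with the quotient norm. An element \<open>F\<close> of the latter is an \<open>L\<^sup>2\<^sub>x\<close>-valued tempered
  distribution (not a function in general, if \<open>\<sigma> < 0\<close>), which is given here by its Fourier transform
  \<open>G\<close> in \<open>t\<close>, formally \<open>F(x,t) = \<integral> exp(i\<pi>\<tau>t) G(x,\<tau>) d\<tau>\<close>. The last clause says that \<open>F\<close> and \<open>h\<close>
  agree, as \<open>L\<^sup>2\<^sub>x\<close>-valued distributions, on \<open>(0,T)\<close>. Only those elements of the space that are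
  functions \<open>h\<close> are considered, as is enough for its intersection with
  \<open>L\<^sup>2\<^sub>t([0,T]; H\<^sup>1\<^sub>x(\<real>))\<close>.\<close>

definition is_Hs_extension ::
  "real \<Rightarrow> real \<Rightarrow> (real \<times> real \<Rightarrow> complex) \<Rightarrow> (real \<times> real \<Rightarrow> complex) \<Rightarrow> bool" where
  "is_Hs_extension \<sigma> T h G \<longleftrightarrow>
     L2_on UNIV (Hs_weighted \<sigma> G) \<and>
     (\<forall>\<phi>. test_function T \<phi> \<longrightarrow>
        (AE x in lborel.
           (LINT \<tau>|lborel. G (x, \<tau>) * (LINT t|lborel. exp (\<i> * of_real (pi * \<tau> * t)) * \<phi> t)) =
           (LINT t:{0..T}|lborel. h (x, t) * \<phi> t)))"

definition in_Hst_L2x :: "real \<Rightarrow> real \<Rightarrow> (real \<times> real \<Rightarrow> complex) \<Rightarrow> bool" where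
  "in_Hst_L2x \<sigma> T h \<longleftrightarrow> (\<exists>G. is_Hs_extension \<sigma> T h G)"

definition Hst_L2x_norm :: "real \<Rightarrow> real \<Rightarrow> (real \<times> real \<Rightarrow> complex) \<Rightarrow> real" where
  "Hst_L2x_norm \<sigma> T h = Inf {L2_norm_on UNIV (Hs_weighted \<sigma> G) | G. is_Hs_extension \<sigma> T h G}"

text \<open>The defining expression of \<open>W\<^bsub>b1\<^esub>[h]\<close> with the sum restricted to \<open>|n| \<le> N\<close>. For \<open>h\<close> in
  \<open>L\<^sup>2\<^sub>t([0,T]; H\<^sup>1\<^sub>x(\<real>))\<close> its integrals converge absolutely. The sum over all \<open>n\<close> does not converge
  absolutely, even for smooth \<open>h\<close> (its terms are then of size \<open>1/n\<close>); as usual for Fourier series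
  of \<open>L\<^sup>2\<close> functions, it is understood as the limit of the symmetric partial sums in \<open>L\<^sup>2\<close>.\<close>

definition Wb1_partial ::
  "real \<Rightarrow> (real \<times> real \<Rightarrow> complex) \<Rightarrow> nat \<Rightarrow> real \<times> real \<times> real \<Rightarrow> complex" where
  "Wb1_partial T h N = (\<lambda>(x, y, t).
     LINT \<xi>|lborel. (\<Sum>n = - int N..int N. of_int n *
       (LINT \<tau>:{0..t}|lborel.
          exp (- \<i> * of_real (pi\<^sup>2 * (\<xi>\<^sup>2 + (of_int n)\<^sup>2) * (t - \<tau>))
               + \<i> * of_real (pi * (\<xi> * x + of_int n * y)))
          * fourier_x T h (\<xi>, \<tau>))))"

text \<open>\<open>W\<^bsub>b1\<^esub>[h] = u\<close> in \<open>L\<^sup>2(\<real> \<times> [0,1] \<times> [0,T])\<close>. Such \<open>u\<close> is unique almost everywhere; if there is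
  none, the \<open>L\<^sup>2\<close> norm of \<open>W\<^bsub>b1\<^esub>[h]\<close> is infinite.\<close>

definition is_Wb1 ::
  "real \<Rightarrow> (real \<times> real \<Rightarrow> complex) \<Rightarrow> (real \<times> real \<times> real \<Rightarrow> complex) \<Rightarrow> bool" where
  "is_Wb1 T h u \<longleftrightarrow>
     L2_on (UNIV \<times> {0..1} \<times> {0..T}) u \<and>
     L2_tendsto_on (UNIV \<times> {0..1} \<times> {0..T}) (Wb1_partial T h) u"

end

theory Submission
  imports Defs "HOL-Probability.Levy" "HOL-Probability.Sinc_Integral"
begin

text \<open>The estimate fails for \<open>\<sigma> < 1/2\<close> because of resonance. The datum is
  \<open>h(x,t) = a(x) b(t) exp(-i\<pi>\<^sup>2N\<^sup>2t)\<close>, whose transforms in \<open>x\<close> and in \<open>t\<close> are, up to the frequency shift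
  \<open>-\<pi>N\<^sup>2\<close> in time, the indicator function of a short interval \<open>[0,e]\<close>. Its \<open>H\<^sup>\<sigma>\<^sub>t L\<^sup>2\<^sub>x\<close> norm is
  \<open>O(N\<^bsup>2 max(\<sigma>,0)\<^esup>)\<close> and its \<open>L\<^sup>2\<^sub>t H\<^sup>1\<^sub>x\<close> norm is \<open>O(1)\<close>. In the modes \<open>n = \<plusminus>N\<close> of \<open>W\<^bsub>b1\<^esub>[h]\<close> the time
  oscillations cancel, and if \<open>e\<close> is small all remaining phases are small too. Testing \<open>W\<^bsub>b1\<^esub>[h]\<close> on the box
  \<open>[0,e] \<times> [0,1] \<times> [0,T]\<close> against \<open>sin(\<pi>Ny) exp(i\<pi>\<^sup>2N\<^sup>2t)\<close> gives \<open>i N\<close> times a number bounded away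
  from zero. Hence \<open>N \<lesssim> N\<^bsup>2 max(\<sigma>,0)\<^esup> + 1\<close> for all \<open>N\<close>.\<close>

section \<open>Uniqueness of the Fourier transform\<close>

text \<open>The positive and negative parts of \<open>r\<close>, normalized to probability densities, have the same
  characteristic function, so Levy's uniqueness theorem applies.\<close>

lemma fourier_L1_zero_real:
  fixes r :: "real \<Rightarrow> real"
  assumes r: "integrable lborel r"
    and zero: "\<And>x. (LINT \<xi>|lborel. iexp (x * \<xi>) * of_real (r \<xi>)) = 0"
  shows "AE \<xi> in lborel. r \<xi> = 0"
proof -
  define m where "m = (LINT \<xi>|lborel. max 0 (r \<xi>))"
  have [measurable]: "r \<in> borel_measurable borel"
    using r by (simp add: borel_measurable_integrable)
  have ip: "integrable lborel (\<lambda>\<xi>. max 0 (r \<xi>))" and iq: "integrable lborel (\<lambda>\<xi>. max 0 (- r \<xi>))"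
    using r by (auto intro!: Bochner_Integration.integrable_bound[OF r])
  have exp_int: "integrable lborel (\<lambda>\<xi>. iexp (x * \<xi>) * of_real (f \<xi>))"
    if "integrable lborel f" for f :: "real \<Rightarrow> real" and x
  proof (rule Bochner_Integration.integrable_bound[OF that])
    have "f \<in> borel_measurable borel" using that by (simp add: borel_measurable_integrable)
    then show "(\<lambda>\<xi>. iexp (x * \<xi>) * of_real (f \<xi>)) \<in> borel_measurable lborel" by measurable
  qed (simp add: norm_mult)
  have split: "r \<xi> = max 0 (r \<xi>) - max 0 (- r \<xi>)" for \<xi> by auto
  have eq: "(LINT \<xi>|lborel. iexp (x * \<xi>) * of_real (max 0 (r \<xi>))) =
      (LINT \<xi>|lborel. iexp (x * \<xi>) * of_real (max 0 (- r \<xi>)))" for x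
  proof -
    have "0 = (LINT \<xi>|lborel. iexp (x * \<xi>) * of_real (max 0 (r \<xi>)) - iexp (x * \<xi>) * of_real (max 0 (- r \<xi>)))"
      unfolding zero[of x, symmetric]
      by (intro Bochner_Integration.integral_cong) (auto simp: max_def)
    also have "\<dots> = (LINT \<xi>|lborel. iexp (x * \<xi>) * of_real (max 0 (r \<xi>))) -
      (LINT \<xi>|lborel. iexp (x * \<xi>) * of_real (max 0 (- r \<xi>)))"
      by (intro Bochner_Integration.integral_diff exp_int ip iq)
    finally show ?thesis by simp
  qed
  \<comment> \<open>At \<open>x = 0\<close> both parts turn out to have the same mass, so one
    normalizing constant \<open>m\<close> serves for both; if \<open>m = 0\<close>, both vanish
    almost everywhere.\<close>
  have mq: "(LINT \<xi>|lborel. max 0 (- r \<xi>)) = m"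
    using eq[of 0] unfolding m_def by simp
  have "m \<ge> 0" by (simp add: m_def)
  show ?thesis
  proof (cases "m = 0")
    case True
    have "AE \<xi> in lborel. max 0 (r \<xi>) = 0"
      using True ip unfolding m_def by (subst (asm) integral_nonneg_eq_0_iff_AE) auto
    moreover have "AE \<xi> in lborel. max 0 (- r \<xi>) = 0"
      using mq iq unfolding True by (subst (asm) integral_nonneg_eq_0_iff_AE) auto
    ultimately show ?thesis by eventually_elim (auto simp: max_def split: if_splits)
  next
    case False
    with \<open>m \<ge> 0\<close> have m: "m > 0" by simp
    define D where "D f = density lborel (\<lambda>\<xi>. ennreal (max 0 (f \<xi>) / m))" for f :: "real \<Rightarrow> real"
    have dist: "real_distribution (D f)"
      if [measurable]: "f \<in> borel_measurable borel" and i: "integrable lborel (\<lambda>\<xi>. max 0 (f \<xi>))"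
        and e: "(LINT \<xi>|lborel. max 0 (f \<xi>)) = m" for f
    proof -
      have "emeasure (D f) (space (D f)) = (\<integral>\<^sup>+\<xi>. ennreal (max 0 (f \<xi>) / m) \<partial>lborel)"
        by (simp add: D_def emeasure_density)
      also have "\<dots> = ennreal (LINT \<xi>|lborel. max 0 (f \<xi>) / m)"
        using i m by (intro nn_integral_eq_integral) auto
      also have "\<dots> = 1" using e m by simp
      finally have "prob_space (D f)" by (rule prob_spaceI)
      then show ?thesis
        unfolding real_distribution_def real_distribution_axioms_def by (simp add: D_def)
    qed
    have char: "char (D f) x = (LINT \<xi>|lborel. iexp (x * \<xi>) * of_real (max 0 (f \<xi>))) / m"
      if [measurable]: "f \<in> borel_measurable borel" for f x
      unfolding char_def D_def using m
      by (subst integral_density) (auto simp: scaleR_conv_of_real mult_ac simp flip: integral_divide_zero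
          intro!: Bochner_Integration.integral_cong)
    have "D r = D (\<lambda>\<xi>. - r \<xi>)"
      by (intro Levy_uniqueness dist ext) (use ip iq mq eq in \<open>auto simp: char m_def\<close>)
    then have "AE \<xi> in lborel. ennreal (max 0 (r \<xi>) / m) = ennreal (max 0 (- r \<xi>) / m)"
      unfolding D_def by (intro sigma_finite_measure.density_unique[OF sigma_finite_lborel]) auto
    then show ?thesis
      by eventually_elim (use m in \<open>auto simp: max_def divide_simps split: if_splits\<close>)
  qed
qed

text \<open>Conjugating the hypothesis at \<open>-x\<close> shows that \<open>cnj f\<close> also has
  vanishing transform; hence so have the real and imaginary parts of \<open>f\<close>, and the real
  case applies to each.\<close>

lemma fourier_L1_zero:
  fixes f :: "real \<Rightarrow> complex"
  assumes f: "integrable lborel f"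
    and zero: "\<And>x. (LINT \<xi>|lborel. iexp (x * \<xi>) * f \<xi>) = 0"
  shows "AE \<xi> in lborel. f \<xi> = 0"
proof -
  have [measurable]: "f \<in> borel_measurable borel"
    using f by (simp add: borel_measurable_integrable)
  have i: "integrable lborel (\<lambda>\<xi>. iexp (x * \<xi>) * f \<xi>)" for x
    by (rule Bochner_Integration.integrable_bound[OF f]) (auto simp: norm_mult)
  have ic: "integrable lborel (\<lambda>\<xi>. iexp (x * \<xi>) * cnj (f \<xi>))" for x
    using integrable_cnj[OF i[of "- x"]] by (simp add: exp_cnj)
  have zc: "(LINT \<xi>|lborel. iexp (x * \<xi>) * cnj (f \<xi>)) = 0" for x
  proof -
    have "(LINT \<xi>|lborel. iexp (x * \<xi>) * cnj (f \<xi>)) = (LINT \<xi>|lborel. cnj (iexp (- x * \<xi>) * f \<xi>))"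
      by (intro Bochner_Integration.integral_cong) (auto simp: exp_cnj)
    also have "\<dots> = cnj (LINT \<xi>|lborel. iexp (- x * \<xi>) * f \<xi>)" by (intro integral_bounded_linear[OF bounded_linear_cnj] i)
    finally show ?thesis by (simp only: zero) simp
  qed
  have "AE \<xi> in lborel. Re (f \<xi>) = 0"
  proof (rule fourier_L1_zero_real)
    show "(LINT \<xi>|lborel. iexp (x * \<xi>) * of_real (Re (f \<xi>))) = 0" for x
    proof -
      have "(LINT \<xi>|lborel. iexp (x * \<xi>) * of_real (Re (f \<xi>))) =
        (LINT \<xi>|lborel. (iexp (x * \<xi>) * f \<xi> + iexp (x * \<xi>) * cnj (f \<xi>)) / 2)"
        by (intro Bochner_Integration.integral_cong) (simp_all add: complex_add_cnj flip: distrib_left)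
      then show ?thesis using i[of x] ic[of x] zero[of x] zc[of x] by simp
    qed
  qed (use f in simp)
  moreover have "AE \<xi> in lborel. Im (f \<xi>) = 0"
  proof (rule fourier_L1_zero_real)
    show "(LINT \<xi>|lborel. iexp (x * \<xi>) * of_real (Im (f \<xi>))) = 0" for x
    proof -
      have "(LINT \<xi>|lborel. iexp (x * \<xi>) * of_real (Im (f \<xi>))) =
        (LINT \<xi>|lborel. (iexp (x * \<xi>) * f \<xi> - iexp (x * \<xi>) * cnj (f \<xi>)) / (2 * \<i>))"
      proof (intro Bochner_Integration.integral_cong refl)
        fix \<xi>
        have "of_real (Im (f \<xi>)) = (f \<xi> - cnj (f \<xi>)) / (2 * \<i>)"
          by (simp add: complex_eq_iff)
        then show "iexp (x * \<xi>) * of_real (Im (f \<xi>)) =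
            (iexp (x * \<xi>) * f \<xi> - iexp (x * \<xi>) * cnj (f \<xi>)) / (2 * \<i>)"
          by (simp only: times_divide_eq_right right_diff_distrib)
      qed
      then show ?thesis using i[of x] ic[of x] zero[of x] zc[of x] by simp
    qed
  qed (use f in simp)
  ultimately show ?thesis by eventually_elim (simp add: complex_eq_iff)
qed

text \<open>The set where \<open>F\<close> does not vanish is open, and a nonempty open set contains
  a ball, which has positive measure.\<close>

lemma continuous_AE_zero:
  fixes F :: "'a::euclidean_space \<Rightarrow> 'b::real_normed_vector"
  assumes "continuous_on UNIV F" and "AE x in lborel. F x = 0"
  shows "F x = 0"
proof (rule ccontr)
  assume nz: "F x \<noteq> 0"
  have "open {x. F x \<noteq> 0}"
    using assms(1) by (intro open_Collect_neq) auto
  with nz obtain e where e: "e > 0" "ball x e \<subseteq> {x. F x \<noteq> 0}"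
    by (auto elim: openE)
  have "AE y in lborel. y \<notin> ball x e"
    using assms(2) by eventually_elim (use e in auto)
  then have "emeasure lborel (ball x e) = 0"
    by (subst (asm) AE_iff_measurable[of "ball x e"]) auto
  with e(1) show False by (simp add: emeasure_ball less_imp_neq[OF unit_ball_vol_pos, symmetric])
qed

text \<open>The transform of an integrable function is continuous by dominated convergence, so
  equality at almost every \<open>x\<close> extends to every \<open>x\<close>.\<close>

lemma fourier_L1_unique_AE:
  fixes f g :: "real \<Rightarrow> complex"
  assumes f: "integrable lborel f" and g: "integrable lborel g"
    and eq: "AE x in lborel. (LINT \<xi>|lborel. exp (\<i> * of_real (pi * x * \<xi>)) * f \<xi>) =
      (LINT \<xi>|lborel. exp (\<i> * of_real (pi * x * \<xi>)) * g \<xi>)"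
  shows "AE \<xi> in lborel. f \<xi> = g \<xi>"
proof -
  define F where "F x = (LINT \<xi>|lborel. exp (\<i> * of_real (pi * x * \<xi>)) * (f \<xi> - g \<xi>))" for x
  have [measurable]: "f \<in> borel_measurable borel" "g \<in> borel_measurable borel"
    using f g by (auto simp: borel_measurable_integrable)
  have i: "integrable lborel (\<lambda>\<xi>. exp (\<i> * of_real (pi * x * \<xi>)) * h \<xi>)"
    if "integrable lborel h" for x and h :: "real \<Rightarrow> complex"
  proof (rule Bochner_Integration.integrable_bound[OF that])
    have "h \<in> borel_measurable borel" using that by (simp add: borel_measurable_integrable)
    then show "(\<lambda>\<xi>. exp (\<i> * of_real (pi * x * \<xi>)) * h \<xi>) \<in> borel_measurable lborel" by measurable
  qed (simp add: norm_mult)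
  have "continuous_on UNIV F"
    unfolding continuous_on_sequentially comp_def
  proof safe
    fix X :: "nat \<Rightarrow> real" and x assume [tendsto_intros]: "X \<longlonglongrightarrow> x"
    show "(\<lambda>n. F (X n)) \<longlonglongrightarrow> F x"
      unfolding F_def
    proof (rule integral_dominated_convergence)
      show "integrable lborel (\<lambda>\<xi>. norm (f \<xi> - g \<xi>))" using f g by auto
    qed (auto simp: norm_mult intro!: tendsto_intros)
  qed
  moreover have "AE x in lborel. F x = 0"
    using eq by eventually_elim (use f g i in \<open>simp add: F_def right_diff_distrib\<close>)
  ultimately have F: "F x = 0" for x by (rule continuous_AE_zero)
  have "AE \<xi> in lborel. f \<xi> - g \<xi> = 0"
  proof (rule fourier_L1_zero)
    show "(LINT \<xi>|lborel. iexp (x * \<xi>) * (f \<xi> - g \<xi>)) = 0" for x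
      using F[of "x / pi"] by (simp add: F_def)
  qed (use f g in simp)
  then show ?thesis by simp
qed

text \<open>Uniqueness in \<open>\<xi>\<close> is available for almost every fixed \<open>t\<close>.
  The quantifiers are swapped because \<open>Wb1_partial\<close> integrates over
  \<open>\<tau>\<close> first, with \<open>\<xi>\<close> fixed; the swap rests on joint
  measurability on the strip.\<close>

lemma is_fourier_x_unique:
  assumes g1: "is_fourier_x T h g1" and g2: "is_fourier_x T h g2"
  shows "AE \<xi> in lborel. AE t in lborel. t \<in> {0..T} \<longrightarrow> g1 (\<xi>, t) = g2 (\<xi>, t)"
proof -
  have [measurable]: "(\<lambda>p. indicator (UNIV \<times> {0..T}) p *\<^sub>R g1 p) \<in> borel_measurable (lborel \<Otimes>\<^sub>M lborel)"
    "(\<lambda>p. indicator (UNIV \<times> {0..T}) p *\<^sub>R g2 p) \<in> borel_measurable (lborel \<Otimes>\<^sub>M lborel)"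
    using g1 g2 by (simp_all add: is_fourier_x_def set_borel_measurable_def lborel_prod)
  have "AE t in lborel. AE \<xi> in lborel. t \<in> {0..T} \<longrightarrow> g1 (\<xi>, t) = g2 (\<xi>, t)"
    using g1[unfolded is_fourier_x_def, THEN conjunct2] g2[unfolded is_fourier_x_def, THEN conjunct2]
  proof eventually_elim
    case (elim t)
    show ?case
    proof (cases "t \<in> {0..T}")
      case True
      with elim have i: "integrable lborel (\<lambda>\<xi>. g1 (\<xi>, t))" "integrable lborel (\<lambda>\<xi>. g2 (\<xi>, t))"
        and e: "AE x in lborel. h (x, t) = (LINT \<xi>|lborel. exp (\<i> * of_real (pi * x * \<xi>)) * g1 (\<xi>, t))"
          "AE x in lborel. h (x, t) = (LINT \<xi>|lborel. exp (\<i> * of_real (pi * x * \<xi>)) * g2 (\<xi>, t))"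
        by auto
      have "AE \<xi> in lborel. g1 (\<xi>, t) = g2 (\<xi>, t)"
        by (rule fourier_L1_unique_AE[OF i]) (use e in eventually_elim, erule (1) trans[OF sym])
      then show ?thesis by simp
    qed auto
  qed
  moreover have "{p \<in> space (lborel \<Otimes>\<^sub>M lborel). snd p \<in> {0..T} \<longrightarrow> g1 (fst p, snd p) = g2 (fst p, snd p)} \<in>
      sets (lborel \<Otimes>\<^sub>M lborel)" (is "?A \<in> _")
  proof -
    have "?A = {p \<in> space (lborel \<Otimes>\<^sub>M lborel).
        indicator (UNIV \<times> {0..T}) p *\<^sub>R g1 p = indicator (UNIV \<times> {0..T}) p *\<^sub>R g2 p}"
      by (auto simp: indicator_def)
    also have "\<dots> \<in> sets (lborel \<Otimes>\<^sub>M lborel)" by measurable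
    finally show ?thesis .
  qed
  ultimately show ?thesis
    by (subst lborel_pair.AE_commute) auto
qed

lemma is_fourier_x_fourier_x: "is_fourier_x T h g \<Longrightarrow> is_fourier_x T h (fourier_x T h)"
  unfolding fourier_x_def by (rule someI[where P = "is_fourier_x T h"])

section \<open>Oscillatory integrals\<close>

lemma (in pair_sigma_finite)
  fixes f g :: "_ \<Rightarrow> 'c::{real_normed_field, banach, second_countable_topology}"
  assumes f: "integrable M1 f" and g: "integrable M2 g"
  shows integrable_prod_mult: "integrable (M1 \<Otimes>\<^sub>M M2) (\<lambda>(x, y). f x * g y)"
    and integral_prod_mult: "(\<integral>(x, y). f x * g y \<partial>(M1 \<Otimes>\<^sub>M M2)) = integral\<^sup>L M1 f * integral\<^sup>L M2 g"
proof -
  have [measurable]: "f \<in> borel_measurable M1" "g \<in> borel_measurable M2"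
    using f g by auto
  show *: "integrable (M1 \<Otimes>\<^sub>M M2) (\<lambda>(x, y). f x * g y)"
    by (rule Fubini_integrable) (use f g in \<open>auto simp: norm_mult\<close>)
  show "(\<integral>(x, y). f x * g y \<partial>(M1 \<Otimes>\<^sub>M M2)) = integral\<^sup>L M1 f * integral\<^sup>L M2 g"
    using f g by (simp add: integral_fst[symmetric, OF *])
qed

lemma Re_integral_ge:
  fixes f :: "'a \<Rightarrow> complex" and g :: "'a \<Rightarrow> real"
  assumes "integrable M f" "integrable M g" "\<And>x. x \<in> space M \<Longrightarrow> g x \<le> Re (f x)"
  shows "integral\<^sup>L M g \<le> Re (integral\<^sup>L M f)"
proof -
  have "integral\<^sup>L M g \<le> (\<integral>x. Re (f x) \<partial>M)"
    using assms by (intro integral_mono) auto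
  then show ?thesis using assms(1) by simp
qed

lemma norm_iexp_diff_one: "cmod (iexp x - 1) \<le> \<bar>x\<bar>"
  using iexp_approx1[of x 0] by simp

text \<open>Both factors \<open>a\<close> and \<open>b\<close> of the datum are \<open>wave e\<close>. A short interval \<open>[0,e]\<close> makes
  them nearly constant on \<open>[0,T]\<close>, see \<open>cmod_wave_diff_le\<close>.\<close>

definition wave :: "real \<Rightarrow> real \<Rightarrow> complex" where
  "wave e s = (LINT r:{0..e}|lborel. exp (\<i> * of_real (pi * s * r)))"

lemma wave_measurable [measurable]: "wave e \<in> borel_measurable borel"
  unfolding wave_def set_lebesgue_integral_def by measurable

lemma wave_integrable: "set_integrable lborel {0..e} (\<lambda>r. exp (\<i> * of_real (pi * s * r)))"
  by (intro borel_integrable_atLeastAtMost' continuous_intros)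

lemma cmod_wave_le: "0 \<le> e \<Longrightarrow> cmod (wave e s) \<le> e"
  using set_integral_norm_bound[OF wave_integrable, of e s] by (simp add: wave_def set_lebesgue_integral_def)

lemma cmod_wave_diff_le:
  assumes "0 \<le> e"
  shows "cmod (wave e s - of_real e) \<le> e * (pi * e * \<bar>s\<bar>)"
proof -
  have "wave e s - of_real e = (LINT r:{0..e}|lborel. exp (\<i> * of_real (pi * s * r)) - 1)"
    using assms wave_integrable[of e s]
    by (subst set_integral_diff(2)) (auto simp: wave_def set_lebesgue_integral_def set_integrable_def scaleR_conv_of_real)
  also have "cmod \<dots> \<le> (LINT r:{0..e}|lborel. cmod (exp (\<i> * of_real (pi * s * r)) - 1))"
    by (intro set_integral_norm_bound borel_integrable_atLeastAtMost' continuous_intros)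
  also have "\<dots> \<le> (LINT r:{0..e}|lborel. pi * e * \<bar>s\<bar>)"
  proof (intro set_integral_mono borel_integrable_atLeastAtMost' continuous_intros)
    fix r assume r: "r \<in> {0..e}"
    have "cmod (exp (\<i> * of_real (pi * s * r)) - 1) \<le> \<bar>pi * s * r\<bar>"
      by (rule norm_iexp_diff_one)
    also have "\<dots> = pi * r * \<bar>s\<bar>" using r by (simp add: abs_mult)
    also have "\<dots> \<le> pi * e * \<bar>s\<bar>" using r by (intro mult_right_mono) auto
    finally show "cmod (exp (\<i> * of_real (pi * s * r)) - 1) \<le> pi * e * \<bar>s\<bar>" .
  qed
  also have "\<dots> = e * (pi * e * \<bar>s\<bar>)"
    using assms by (simp add: set_lebesgue_integral_def)
  finally show ?thesis .
qed

text \<open>Evaluating the integral leaves a difference of two numbers of modulus 1, divided by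
  \<open>pi * s\<close> up to the factor \<open>i\<close>; the bound \<open>2 / pi\<close> is
  rounded up to 2.\<close>

lemma cmod_wave_decay:
  assumes "0 \<le> e"
  shows "\<bar>s\<bar> * cmod (wave e s) \<le> 2"
proof (cases "s = 0")
  case False
  have "wave e s = exp (\<i> * of_real (pi * s * e)) / (\<i> * of_real (pi * s)) - 
      exp (\<i> * of_real (pi * s * 0)) / (\<i> * of_real (pi * s))"
    unfolding wave_def set_lebesgue_integral_def
    using False
    by (intro integral_FTC_atLeastAtMost assms continuous_intros)
      (auto intro!: derivative_eq_intros has_vector_derivative_real_field simp: field_simps)
  also have "\<dots> = (exp (\<i> * of_real (pi * s * e)) - 1) / (\<i> * of_real (pi * s))"
    by (simp add: diff_divide_distrib)
  finally have "\<bar>s\<bar> * cmod (wave e s) = cmod (exp (\<i> * of_real (pi * s * e)) - 1) / pi"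
    using False by (simp add: norm_divide norm_mult)
  also have "\<dots> \<le> 2 / 1"
  proof (rule frac_le)
    show "cmod (exp (\<i> * of_real (pi * s * e)) - 1) \<le> 2"
      by (rule order_trans[OF norm_triangle_ineq4]) simp
  qed (use pi_gt3 in auto)
  finally show ?thesis by simp
qed simp

text \<open>\<open>wave e\<close> is bounded and decays like \<open>1 / s\<close>, so its square is
  dominated by a multiple of \<open>1 / (1 + s^2)\<close>. This puts the spatial factor of the datum
  in \<open>L^2\<close>.\<close>

lemma wave_square_integrable:
  assumes "0 \<le> e"
  shows "integrable lborel (\<lambda>s. (cmod (wave e s))\<^sup>2)"
proof (rule Bochner_Integration.integrable_bound)
  show "integrable lborel (\<lambda>s::real. (e\<^sup>2 + 4) * inverse (1 + s\<^sup>2))"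
    using integrable_inverse_1_plus_square by (simp add: set_integrable_def)
  show "AE s in lborel. norm ((cmod (wave e s))\<^sup>2) \<le> norm ((e\<^sup>2 + 4) * inverse (1 + s\<^sup>2))"
  proof (rule AE_I2)
    fix s :: real
    have "(cmod (wave e s))\<^sup>2 \<le> e\<^sup>2" "(\<bar>s\<bar> * cmod (wave e s))\<^sup>2 \<le> 2\<^sup>2"
      by (intro power_mono cmod_wave_le cmod_wave_decay assms; simp)+
    then have "(cmod (wave e s))\<^sup>2 * (1 + s\<^sup>2) \<le> e\<^sup>2 + 4"
      by (simp add: power_mult_distrib algebra_simps)
    moreover have "1 + s\<^sup>2 > 0" by (simp add: add_pos_nonneg)
    ultimately show "norm ((cmod (wave e s))\<^sup>2) \<le> norm ((e\<^sup>2 + 4) * inverse (1 + s\<^sup>2))"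
      by (simp add: abs_mult field_simps)
  qed
qed measurable

section \<open>Sine coefficients of exponentials on the unit interval\<close>

lemma integral_cos_int:
  "(LINT y:{0..1}|lborel. cos (pi * of_int k * y)) = (if k = 0 then 1 else 0)"
proof (cases "k = 0")
  case True
  then show ?thesis by (simp add: set_lebesgue_integral_def)
next
  case False
  have "(LINT y:{0..1}|lborel. cos (pi * of_int k * y)) =
      sin (pi * of_int k * 1) / (pi * of_int k) - sin (pi * of_int k * 0) / (pi * of_int k)"
    unfolding set_lebesgue_integral_def
    using False by (intro integral_FTC_atLeastAtMost continuous_intros)
      (auto intro!: derivative_eq_intros simp: field_simps simp flip: has_real_derivative_iff_has_vector_derivative)
  also have "sin (pi * of_int k * 1) = 0"
    by (simp add: sin_zero_iff_int2 mult.commute)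
  finally show ?thesis using False by simp
qed

lemma integral_sin_sin:
  "(LINT y:{0..1}|lborel. sin (pi * of_int n * y) * sin (pi * of_int m * y)) =
    ((if n = m then 1 else 0) - (if n = - m then 1 else 0)) / 2"
proof -
  have "(LINT y:{0..1}|lborel. sin (pi * of_int n * y) * sin (pi * of_int m * y)) =
      (LINT y:{0..1}|lborel. (cos (pi * of_int (n - m) * y) - cos (pi * of_int (n + m) * y)) / 2)"
    by (simp add: algebra_simps cos_diff cos_add)
  also have "\<dots> = ((LINT y:{0..1}|lborel. cos (pi * of_int (n - m) * y)) -
      (LINT y:{0..1}|lborel. cos (pi * of_int (n + m) * y))) / 2"
    unfolding set_integral_divide_zero
    by (subst set_integral_diff(2)) (auto intro!: borel_integrable_atLeastAtMost' continuous_intros)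
  also have "\<dots> = ((if n = m then 1 else 0) - (if n = - m then 1 else 0)) / 2"
    unfolding integral_cos_int by (simp add: eq_neg_iff_add_eq_0)
  finally show ?thesis .
qed

definition sin_coeff :: "int \<Rightarrow> int \<Rightarrow> complex" where
  "sin_coeff m n = (LINT y:{0..1}|lborel. exp (\<i> * of_real (pi * of_int n * y)) * of_real (sin (pi * of_int m * y)))"

text \<open>The difference of the two exponentials is \<open>2i sin(pi n y)\<close>, and the nonzero
  sines are orthogonal on \<open>[0,1]\<close> with squared norm 1/2.\<close>

lemma sin_coeff_diff:
  "sin_coeff m n - sin_coeff m (- n) = \<i> * ((if n = m then 1 else 0) - (if n = - m then 1 else 0))"
proof -
  have "sin_coeff m n - sin_coeff m (- n) =
      (LINT y:{0..1}|lborel. exp (\<i> * of_real (pi * of_int n * y)) * of_real (sin (pi * of_int m * y)) -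
         exp (\<i> * of_real (pi * of_int (- n) * y)) * of_real (sin (pi * of_int m * y)))"
    unfolding sin_coeff_def
    by (subst set_integral_diff(2)) (auto intro!: borel_integrable_atLeastAtMost' continuous_intros)
  also have "\<dots> = (LINT y:{0..1}|lborel. 2 * \<i> * of_real (sin (pi * of_int n * y) * sin (pi * of_int m * y)))"
    by (intro set_lebesgue_integral_cong) (auto simp: complex_eq_iff Re_exp Im_exp)
  also have "\<dots> = 2 * \<i> * of_real (LINT y:{0..1}|lborel. sin (pi * of_int n * y) * sin (pi * of_int m * y))"
    by (simp add: set_lebesgue_integral_def scaleR_conv_of_real flip: integral_complex_of_real)
  also have "\<dots> = \<i> * ((if n = m then 1 else 0) - (if n = - m then 1 else 0))"
    unfolding integral_sin_sin by simp
  finally show ?thesis .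
qed

text \<open>The factor \<open>n\<close> is odd and \<open>\<Delta>\<close> is even, so averaging the
  sum with its reflection leaves only the odd part of \<open>sin_coeff m\<close>, which vanishes
  except at \<open>n = m\<close> and \<open>n = -m\<close>. Those two contributions are
  equal.\<close>

lemma sum_sin_coeff:
  fixes \<Delta> :: "int \<Rightarrow> complex"
  assumes even: "\<And>n. \<Delta> (- n) = \<Delta> n" and m: "0 < m" "m \<le> K"
  shows "(\<Sum>n = - K..K. of_int n * sin_coeff m n * \<Delta> n) = \<i> * of_int m * \<Delta> m"
proof -
  let ?S = "\<Sum>n = - K..K. of_int n * sin_coeff m n * \<Delta> n"
  have "?S = (\<Sum>n = - K..K. of_int (- n) * sin_coeff m (- n) * \<Delta> (- n))"
    by (rule sum.reindex_bij_witness[of _ uminus uminus]) auto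
  then have "?S + ?S = (\<Sum>n = - K..K. of_int n * (sin_coeff m n - sin_coeff m (- n)) * \<Delta> n)"
    by (simp add: even algebra_simps sum_subtractf flip: sum.distrib)
  also have "\<dots> = (\<Sum>n = - K..K. (if n = m then \<i> * of_int m * \<Delta> m else 0) + (if n = - m then \<i> * of_int m * \<Delta> m else 0))"
    unfolding sin_coeff_diff using m even by (intro sum.cong) (auto simp: algebra_simps)
  also have "\<dots> = 2 * (\<i> * of_int m * \<Delta> m)"
    using m by (simp add: sum.distrib)
  finally show ?thesis by simp
qed

lemma measurable_fst_snd_borel [measurable]:
  "fst \<in> borel_measurable (borel :: ('a::second_countable_topology \<times> 'b::second_countable_topology) measure)"
  "snd \<in> borel_measurable (borel :: ('a::second_countable_topology \<times> 'b::second_countable_topology) measure)"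
  by (simp_all flip: borel_prod)

section \<open>The resonant datum\<close>

lemma test_function_integrable:
  assumes "test_function T \<phi>"
  shows "integrable lborel \<phi>"
proof -
  from assms obtain D a b where D: "D 0 = \<phi>" "\<And>n t. (D n has_vector_derivative D (Suc n) t) (at t)"
    and ab: "\<And>t. t \<notin> {a..b} \<Longrightarrow> \<phi> t = 0"
    unfolding test_function_def by blast
  have "continuous_on {a..b} \<phi>"
    using D(2)[of 0] D(1) by (auto intro!: continuous_at_imp_continuous_on has_vector_derivative_continuous)
  then have "set_integrable lborel {a..b} \<phi>" by (rule borel_integrable_atLeastAtMost')
  moreover have "indicator {a..b} t *\<^sub>R \<phi> t = \<phi> t" for t using ab[of t] by (auto simp: indicator_def)
  ultimately show ?thesis by (simp add: set_integrable_def)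
qed

lemma integrable_indicator_Icc: "integrable lborel (indicator {a..b::real} :: real \<Rightarrow> complex)"
  using borel_integrable_atLeastAtMost'[of a b "\<lambda>_. 1::complex"]
  by (simp add: set_integrable_def scaleR_conv_of_real of_real_indicator)

text \<open>The three terms of \<open>small\<close> bound the phases \<open>pi \<xi> x\<close> and
  \<open>pi^2 \<xi>^2 (t - \<tau>)\<close> for \<open>x\<close> and \<open>\<xi>\<close> in
  \<open>[0,e]\<close>, and the deviation of \<open>wave e \<tau>\<close> from \<open>e\<close>
  relative to \<open>e\<close>. None of them involves \<open>N\<close>, so \<open>e\<close> can be
  fixed before \<open>N\<close> grows.\<close>

locale resonant_datum =
  fixes T e :: real and N :: nat
  assumes T_pos: "0 < T" and e_pos: "0 < e" and e_le: "e \<le> 1" and N_pos: "0 < N"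
    and small: "pi * e\<^sup>2 + pi\<^sup>2 * e\<^sup>2 * T + pi * e * T \<le> 1 / 2"
begin

definition datum :: "real \<times> real \<Rightarrow> complex" where
  "datum = (\<lambda>(x, t). wave e x * (wave e t * exp (\<i> * of_real (- (pi\<^sup>2 * (real N)\<^sup>2 * t)))))"

definition datum_hat :: "real \<times> real \<Rightarrow> complex" where
  "datum_hat = (\<lambda>(\<xi>, t). indicator {0..e} \<xi> * (wave e t * exp (\<i> * of_real (- (pi\<^sup>2 * (real N)\<^sup>2 * t)))))"

text \<open>In the normalization \<open>exp(i pi \<tau> t)\<close> the time frequency
  \<open>-pi^2 N^2\<close> of the datum corresponds to \<open>\<tau> = -pi N^2\<close>, hence the
  shift in the indicator.\<close>

definition datum_ext :: "real \<times> real \<Rightarrow> complex" where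
  "datum_ext = (\<lambda>(x, \<tau>). wave e x * indicator {0..e} (\<tau> + pi * (real N)\<^sup>2))"

lemma datum_measurable [measurable]: "datum \<in> borel_measurable borel"
  unfolding datum_def borel_prod[symmetric] by measurable

lemma datum_hat_measurable [measurable]: "datum_hat \<in> borel_measurable borel"
  unfolding datum_hat_def borel_prod[symmetric] by measurable

lemma datum_ext_measurable [measurable]: "datum_ext \<in> borel_measurable borel"
  unfolding datum_ext_def borel_prod[symmetric] by measurable

lemma strip_measurable [measurable]: "UNIV \<times> {0..T} \<in> sets (borel :: (real \<times> real) measure)"
  by (intro borel_closed closed_Times) auto

lemma is_fourier_x_datum: "is_fourier_x T datum datum_hat"
  unfolding is_fourier_x_def
proof (intro conjI AE_I2 impI)
  show "set_borel_measurable lborel (UNIV \<times> {0..T}) datum_hat"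
    unfolding set_borel_measurable_def by simp
next
  fix t
  show "integrable lborel (\<lambda>\<xi>. datum_hat (\<xi>, t))"
    unfolding datum_hat_def by (simp add: integrable_indicator_Icc)
next
  fix t x
  have "(LINT \<xi>|lborel. exp (\<i> * of_real (pi * x * \<xi>)) * datum_hat (\<xi>, t)) =
    (LINT \<xi>|lborel. (indicator {0..e} \<xi> *\<^sub>R exp (\<i> * of_real (pi * x * \<xi>))) *
      (wave e t * exp (\<i> * of_real (- (pi\<^sup>2 * (real N)\<^sup>2 * t)))))"
    by (intro Bochner_Integration.integral_cong)
      (auto simp: datum_hat_def indicator_def)
  also have "\<dots> = datum (x, t)"
    by (subst integral_mult_left_zero) (simp add: datum_def wave_def set_lebesgue_integral_def)
  finally show "datum (x, t) = (LINT \<xi>|lborel. exp (\<i> * of_real (pi * x * \<xi>)) * datum_hat (\<xi>, t))" ..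
qed

section \<open>The norm of the datum in \<open>L^2_t H^1_x\<close>\<close>

lemma cmod_datum_hat_le: "cmod (datum_hat (\<xi>, t)) \<le> e * indicator {0..e} \<xi>"
  using cmod_wave_le[of e t] e_pos by (auto simp: datum_hat_def norm_mult indicator_def)

text \<open>On the support of the transform the squared weight is at most \<open>1 + e^2\<close>,
  and the fast modulation in time has modulus 1, so the majorant is independent of
  \<open>N\<close>.\<close>

lemma H1_weighted_datum_hat_le:
  "(cmod (H1_weighted datum_hat p))\<^sup>2 * indicator (UNIV \<times> {0..T}) p \<le>
    (1 + e\<^sup>2) * e\<^sup>2 * indicator ({0..e} \<times> {0..T}) p"
proof -
  obtain \<xi> t where p: "p = (\<xi>, t)" by (cases p)
  show ?thesis
  proof (cases "\<xi> \<in> {0..e} \<and> t \<in> {0..T}")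
    case True
    have "(cmod (H1_weighted datum_hat p))\<^sup>2 = (1 + \<xi>\<^sup>2) * (cmod (datum_hat (\<xi>, t)))\<^sup>2"
      by (simp add: H1_weighted_def p norm_mult power_mult_distrib)
    also have "\<dots> \<le> (1 + e\<^sup>2) * e\<^sup>2"
      using True cmod_datum_hat_le[of \<xi> t] by (intro mult_mono add_left_mono power_mono) auto
    finally show ?thesis using True by (simp add: p)
  next
    case False
    then show ?thesis using cmod_datum_hat_le[of \<xi> t] by (auto simp: p H1_weighted_def indicator_def)
  qed
qed

lemma integrable_box2: "integrable lborel (\<lambda>p. (1 + e\<^sup>2) * e\<^sup>2 * indicator ({0..e} \<times> {0..T}) p :: real)"
proof -
  have "compact ({0..e} \<times> {0..T})" by (intro compact_Times) auto
  then show ?thesis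
    using emeasure_compact_finite[of "{0..e} \<times> {0..T}"]
    by (intro integrable_mult_right integrable_real_indicator) (auto intro: borel_compact)
qed

lemma H1_weighted_measurable: "H1_weighted datum_hat \<in> borel_measurable borel"
proof -
  have "(\<lambda>p. of_real (sqrt (1 + (fst p)\<^sup>2)) * datum_hat p) \<in> borel_measurable borel"
    by measurable
  moreover have "(\<lambda>p. of_real (sqrt (1 + (fst p)\<^sup>2)) * datum_hat p) = H1_weighted datum_hat"
    by (auto simp: H1_weighted_def)
  ultimately show ?thesis by simp
qed

lemma L2_on_H1_weighted_datum_hat: "L2_on (UNIV \<times> {0..T}) (H1_weighted datum_hat)"
proof -
  note [measurable] = H1_weighted_measurable
  have "integrable lborel (\<lambda>p. (cmod (H1_weighted datum_hat p))\<^sup>2 * indicator (UNIV \<times> {0..T}) p)"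
  proof (rule Bochner_Integration.integrable_bound[OF integrable_box2])
    show "AE p in lborel. norm ((cmod (H1_weighted datum_hat p))\<^sup>2 * indicator (UNIV \<times> {0..T}) p) \<le>
        norm ((1 + e\<^sup>2) * e\<^sup>2 * indicator ({0..e} \<times> {0..T}) p :: real)"
      using H1_weighted_datum_hat_le by (intro AE_I2) (simp add: abs_mult abs_of_nonneg)
  qed measurable
  then show ?thesis
    by (simp add: L2_on_def set_borel_measurable_def set_integrable_def mult.commute)
qed

lemma in_L2t_H1x_datum: "in_L2t_H1x T datum"
  unfolding in_L2t_H1x_def set_borel_measurable_def
  using is_fourier_x_datum L2_on_H1_weighted_datum_hat by auto

lemma fourier_x_datum_AE:
  "AE \<xi> in lborel. AE t in lborel. t \<in> {0..T} \<longrightarrow> fourier_x T datum (\<xi>, t) = datum_hat (\<xi>, t)"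
  using is_fourier_x_fourier_x[OF is_fourier_x_datum] is_fourier_x_datum by (rule is_fourier_x_unique)

lemma fourier_x_datum_measurable:
  "(\<lambda>p. indicator (UNIV \<times> {0..T}) p *\<^sub>R fourier_x T datum p) \<in> borel_measurable (lborel \<Otimes>\<^sub>M lborel)"
  using is_fourier_x_fourier_x[OF is_fourier_x_datum]
  by (simp add: is_fourier_x_def set_borel_measurable_def lborel_prod)

text \<open>The norm involves the representative selected by \<open>fourier_x\<close>, which is
  known only up to null sets. It is cut off to the strip, where it is measurable, and then replaced
  by \<open>datum_hat\<close> almost everywhere.\<close>

lemma L2t_H1x_norm_datum_le:
  "L2t_H1x_norm T datum \<le> sqrt (LINT p|lborel. (1 + e\<^sup>2) * e\<^sup>2 * indicator ({0..e} \<times> {0..T}) p)"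
proof -
  let ?F = "\<lambda>p. indicator (UNIV \<times> {0..T}) p *\<^sub>R fourier_x T datum p"
  note [measurable] = H1_weighted_measurable fourier_x_datum_measurable[unfolded lborel_prod]
  have "AE p in lborel \<Otimes>\<^sub>M lborel. ?F p = indicator (UNIV \<times> {0..T}) p *\<^sub>R datum_hat p"
  proof (rule lborel_pair.AE_pair_measure)
    show "{p \<in> space (lborel \<Otimes>\<^sub>M lborel). ?F p = indicator (UNIV \<times> {0..T}) p *\<^sub>R datum_hat p} \<in> sets (lborel \<Otimes>\<^sub>M lborel)"
      unfolding lborel_prod by measurable
    show "AE \<xi> in lborel. AE t in lborel. ?F (\<xi>, t) = indicator (UNIV \<times> {0..T}) (\<xi>, t) *\<^sub>R datum_hat (\<xi>, t)"
      using fourier_x_datum_AE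
    proof eventually_elim
      case (elim \<xi>)
      then show ?case by eventually_elim (auto simp: indicator_def)
    qed
  qed
  then have ae: "AE p in lborel. ?F p = indicator (UNIV \<times> {0..T}) p *\<^sub>R datum_hat p"
    unfolding lborel_prod .
  have "(LINT p:UNIV \<times> {0..T}|lborel. (cmod (H1_weighted (fourier_x T datum) p))\<^sup>2) =
    (LINT p|lborel. (1 + (fst p)\<^sup>2) * (cmod (?F p))\<^sup>2)"
    unfolding set_lebesgue_integral_def
    by (intro Bochner_Integration.integral_cong)
      (auto simp: H1_weighted_def norm_mult power_mult_distrib indicator_def)
  also have "\<dots> = (LINT p|lborel. (1 + (fst p)\<^sup>2) * (cmod (indicator (UNIV \<times> {0..T}) p *\<^sub>R datum_hat p))\<^sup>2)"
  proof (rule integral_cong_AE)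
    have M: "(\<lambda>p. (1 + (fst p)\<^sup>2) * (cmod (F p))\<^sup>2) \<in> borel_measurable lborel"
      if "F \<in> borel_measurable lborel" for F :: "real \<times> real \<Rightarrow> complex"
      using that measurable_fst_snd_borel(1)
      by (intro borel_measurable_times borel_measurable_add borel_measurable_power borel_measurable_norm) auto
    show "(\<lambda>p. (1 + (fst p)\<^sup>2) * (cmod (?F p))\<^sup>2) \<in> borel_measurable lborel"
      by (intro M) measurable
    show "(\<lambda>p. (1 + (fst p)\<^sup>2) * (cmod (indicator (UNIV \<times> {0..T}) p *\<^sub>R datum_hat p))\<^sup>2) \<in> borel_measurable lborel"
      by (intro M) measurable
  qed (use ae in eventually_elim, simp only:)
  also have "\<dots> = (LINT p|lborel. (cmod (H1_weighted datum_hat p))\<^sup>2 * indicator (UNIV \<times> {0..T}) p)"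
    by (intro Bochner_Integration.integral_cong)
      (auto simp: H1_weighted_def norm_mult power_mult_distrib indicator_def)
  also have "\<dots> \<le> (LINT p|lborel. (1 + e\<^sup>2) * e\<^sup>2 * indicator ({0..e} \<times> {0..T}) p)"
    using L2_on_H1_weighted_datum_hat H1_weighted_datum_hat_le
    by (intro integral_mono integrable_box2) (auto simp: L2_on_def set_integrable_def mult.commute)
  finally show ?thesis
    unfolding L2t_H1x_norm_def L2_norm_on_def by simp
qed

section \<open>The extension of the datum in time and its \<open>H^\<sigma>\<close> norm\<close>

text \<open>On the support \<open>\<bar>\<tau>\<bar> \<le> pi N^2\<close>, so \<open>pi < 4\<close>
  gives \<open>1 + \<tau>^2 \<le> 1 + 16 N^4 \<le> 17 N^4\<close>. The exponent
  \<open>max \<sigma> 0\<close> also covers negative \<open>\<sigma>\<close>, where the weight is at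
  most 1.\<close>

lemma Hs_weight_le:
  "((1 + \<tau>\<^sup>2) powr (\<sigma> / 2))\<^sup>2 * indicator {0..e} (\<tau> + pi * (real N)\<^sup>2) \<le>
    (17 * real N ^ 4) powr max \<sigma> 0 * indicator {0..e} (\<tau> + pi * (real N)\<^sup>2)"
proof (cases "\<tau> + pi * (real N)\<^sup>2 \<in> {0..e}")
  case True
  have N1: "1 \<le> real N ^ k" for k using N_pos by simp
  \<comment> \<open>Together with \<open>e \<le> 1\<close> this places the interval
    \<open>[-pi N^2, e - pi N^2]\<close> in the nonpositive reals, so its left end has the largest
    modulus.\<close>
  have M1: "1 \<le> pi * (real N)\<^sup>2"
    using mult_mono[of 1 pi 1 "(real N)\<^sup>2"] pi_gt3 N1 by auto
  with True e_le have "\<bar>\<tau>\<bar> \<le> pi * (real N)\<^sup>2" by auto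
  then have "\<tau>\<^sup>2 \<le> (pi * (real N)\<^sup>2)\<^sup>2" by (metis abs_ge_zero power2_abs power_mono)
  also have "\<dots> \<le> (4 * (real N)\<^sup>2)\<^sup>2"
    by (intro power_mono mult_right_mono) (use pi_less_4 in auto)
  also have "\<dots> = 16 * real N ^ 4" by (simp add: power_mult_distrib flip: power_mult)
  finally have \<tau>: "1 + \<tau>\<^sup>2 \<le> 17 * real N ^ 4" using N1[of 4] by simp
  have "((1 + \<tau>\<^sup>2) powr (\<sigma> / 2))\<^sup>2 = (1 + \<tau>\<^sup>2) powr \<sigma>"
    by (simp add: power2_eq_square flip: powr_add)
  also have "\<dots> \<le> (1 + \<tau>\<^sup>2) powr max \<sigma> 0"
    by (intro powr_mono) auto
  also have "\<dots> \<le> (17 * real N ^ 4) powr max \<sigma> 0"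
    using \<tau> by (intro powr_mono2) auto
  finally show ?thesis using True by simp
qed simp

text \<open>By Fubini the squared norm is the product of the integral of
  \<open>(cmod (wave e x))^2\<close> and that of the squared weight over an interval of length
  \<open>e\<close>; only the latter depends on \<open>N\<close>.\<close>

lemma datum_ext_L2:
  fixes \<sigma> :: real
  shows "L2_on UNIV (Hs_weighted \<sigma> datum_ext)" (is ?L2)
    and "L2_norm_on UNIV (Hs_weighted \<sigma> datum_ext) \<le>
      sqrt ((LINT s|lborel. (cmod (wave e s))\<^sup>2) * (e * (17 * real N ^ 4) powr max \<sigma> 0))" (is ?norm)
proof -
  define w where "w \<tau> = ((1 + \<tau>\<^sup>2) powr (\<sigma> / 2))\<^sup>2 * indicator {0..e} (\<tau> + pi * (real N)\<^sup>2)" for \<tau> :: real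
  define B where "B = (17 * real N ^ 4) powr max \<sigma> 0"
  have shift: "indicator {0..e} (\<tau> + pi * (real N)\<^sup>2) = (indicator {- (pi * (real N)\<^sup>2)..e - pi * (real N)\<^sup>2} \<tau> :: real)" for \<tau>
    by (auto simp: indicator_def)
  have [measurable]: "w \<in> borel_measurable borel" unfolding w_def by measurable
  have iB: "integrable lborel (\<lambda>\<tau>. B * indicator {0..e} (\<tau> + pi * (real N)\<^sup>2))"
    unfolding shift by (intro integrable_mult_right integrable_real_indicator) (auto simp: emeasure_lborel_Icc_eq)
  have w_le: "w \<tau> \<le> B * indicator {0..e} (\<tau> + pi * (real N)\<^sup>2)" for \<tau>
    using Hs_weight_le[of \<tau> \<sigma>] by (simp add: w_def B_def)
  have w0: "0 \<le> w \<tau>" for \<tau> by (simp add: w_def)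
  have iw: "integrable lborel w"
    by (rule Bochner_Integration.integrable_bound[OF iB])
      (use w_le w0 in \<open>auto intro!: AE_I2 intro: order_trans[OF _ abs_ge_self]\<close>)
  have "integral\<^sup>L lborel w \<le> (LINT \<tau>|lborel. B * indicator {0..e} (\<tau> + pi * (real N)\<^sup>2))"
    using iw iB w_le by (intro integral_mono)
  also have "\<dots> = e * B"
    unfolding shift using e_pos by simp
  finally have w_int: "integral\<^sup>L lborel w \<le> e * B" .
  have sq: "(cmod (Hs_weighted \<sigma> datum_ext p))\<^sup>2 = (case p of (x, \<tau>) \<Rightarrow> (cmod (wave e x))\<^sup>2 * w \<tau>)" for p
    by (auto simp: Hs_weighted_def datum_ext_def w_def norm_mult power_mult_distrib indicator_def split: prod.split)
  note wave2 = wave_square_integrable[OF less_imp_le[OF e_pos]]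
  have "(\<lambda>p. of_real ((1 + (snd p)\<^sup>2) powr (\<sigma> / 2)) * datum_ext p) \<in> borel_measurable borel"
    by measurable
  moreover have "(\<lambda>p. of_real ((1 + (snd p)\<^sup>2) powr (\<sigma> / 2)) * datum_ext p) = Hs_weighted \<sigma> datum_ext"
    by (auto simp: Hs_weighted_def)
  ultimately have "Hs_weighted \<sigma> datum_ext \<in> borel_measurable borel" by simp
  then show ?L2
    using lborel_pair.integrable_prod_mult[OF wave2 iw]
    by (simp add: L2_on_def sq set_borel_measurable_def set_integrable_def lborel_prod)
  have "(LINT p:UNIV|lborel. (cmod (Hs_weighted \<sigma> datum_ext p))\<^sup>2) =
      (LINT s|lborel. (cmod (wave e s))\<^sup>2) * integral\<^sup>L lborel w"
    using lborel_pair.integral_prod_mult[OF wave2 iw]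
    by (simp add: sq set_lebesgue_integral_def lborel_prod)
  also have "\<dots> \<le> (LINT s|lborel. (cmod (wave e s))\<^sup>2) * (e * B)"
    by (intro mult_left_mono w_int) simp
  finally show ?norm
    unfolding L2_norm_on_def B_def by simp
qed

text \<open>Fubini moves the \<open>\<tau>\<close> integral inside, and the substitution
  \<open>\<tau> = r - pi N^2\<close> turns it into \<open>wave e t\<close> times the modulation. The
  resulting integral over the line reduces to \<open>{0..T}\<close> because test functions vanish
  outside.\<close>

lemma is_Hs_extension_datum: "is_Hs_extension \<sigma> T datum datum_ext"
  unfolding is_Hs_extension_def
proof (intro conjI allI impI AE_I2 datum_ext_L2)
  fix \<phi> x
  assume \<phi>: "test_function T \<phi>"
  let ?M = "pi * (real N)\<^sup>2"
  note i\<phi> = test_function_integrable[OF \<phi>]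
  have [measurable]: "\<phi> \<in> borel_measurable borel" using i\<phi> by auto
  have shift: "indicator {0..e} (\<tau> + ?M) = (indicator {- ?M..e - ?M} \<tau> :: complex)" for \<tau>
    by (auto simp: indicator_def)
  define f where "f \<tau> t = indicator {0..e} (\<tau> + ?M) * (exp (\<i> * of_real (pi * \<tau> * t)) * \<phi> t)" for \<tau> t
  have "integrable (lborel \<Otimes>\<^sub>M lborel) (case_prod f)"
  proof (rule Bochner_Integration.integrable_bound)
    show "integrable (lborel \<Otimes>\<^sub>M lborel) (\<lambda>(\<tau>, t). indicator {0..e} (\<tau> + ?M) * \<phi> t)"
      by (intro lborel_pair.integrable_prod_mult i\<phi>) (simp add: shift integrable_indicator_Icc)
    show "case_prod f \<in> borel_measurable (lborel \<Otimes>\<^sub>M lborel)" unfolding f_def by measurable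
  qed (auto simp: f_def norm_mult)
  then have "(LINT \<tau>|lborel. LINT t|lborel. f \<tau> t) = (LINT t|lborel. LINT \<tau>|lborel. f \<tau> t)"
    by (rule lborel_pair.Fubini_integral[symmetric])
  also have "\<dots> = (LINT t|lborel. (wave e t * exp (\<i> * of_real (- (pi\<^sup>2 * (real N)\<^sup>2 * t)))) * \<phi> t)"
  proof (intro Bochner_Integration.integral_cong refl)
    fix t
    have "(LINT \<tau>|lborel. f \<tau> t) = (LINT r|lborel. f (- ?M + 1 * r) t)"
      by (subst lborel_integral_real_affine[where c=1 and t="- ?M"]) auto
    also have "\<dots> = (LINT r|lborel. (indicator {0..e} r *\<^sub>R exp (\<i> * of_real (pi * t * r))) *
        (exp (\<i> * of_real (- (pi\<^sup>2 * (real N)\<^sup>2 * t))) * \<phi> t))"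
      by (intro Bochner_Integration.integral_cong refl)
        (auto simp: f_def indicator_def algebra_simps power2_eq_square simp flip: exp_add)
    also have "\<dots> = wave e t * (exp (\<i> * of_real (- (pi\<^sup>2 * (real N)\<^sup>2 * t))) * \<phi> t)"
      by (subst integral_mult_left_zero) (simp add: wave_def set_lebesgue_integral_def)
    finally show "(LINT \<tau>|lborel. f \<tau> t) = (wave e t * exp (\<i> * of_real (- (pi\<^sup>2 * (real N)\<^sup>2 * t)))) * \<phi> t"
      by simp
  qed
  finally have eq: "(LINT \<tau>|lborel. LINT t|lborel. f \<tau> t) =
    (LINT t|lborel. (wave e t * exp (\<i> * of_real (- (pi\<^sup>2 * (real N)\<^sup>2 * t)))) * \<phi> t)" .
  have "(LINT \<tau>|lborel. datum_ext (x, \<tau>) * (LINT t|lborel. exp (\<i> * of_real (pi * \<tau> * t)) * \<phi> t)) =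
    (LINT \<tau>|lborel. wave e x * (LINT t|lborel. f \<tau> t))"
    unfolding f_def datum_ext_def by (simp add: mult.assoc)
  also have "\<dots> = wave e x * (LINT t|lborel. (wave e t * exp (\<i> * of_real (- (pi\<^sup>2 * (real N)\<^sup>2 * t)))) * \<phi> t)"
    unfolding eq[symmetric] by simp
  also have "\<dots> = (LINT t|lborel. datum (x, t) * \<phi> t)"
    by (simp add: datum_def mult.assoc flip: integral_mult_right_zero)
  also have "\<dots> = (LINT t:{0..T}|lborel. datum (x, t) * \<phi> t)"
    unfolding set_lebesgue_integral_def
  proof (intro Bochner_Integration.integral_cong refl)
    fix t
    show "datum (x, t) * \<phi> t = indicator {0..T} t *\<^sub>R (datum (x, t) * \<phi> t)"
      using \<phi> unfolding test_function_def by (cases "t \<in> {0..T}") force+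
  qed
  finally show "(LINT \<tau>|lborel. datum_ext (x, \<tau>) * (LINT t|lborel. exp (\<i> * of_real (pi * \<tau> * t)) * \<phi> t)) =
    (LINT t:{0..T}|lborel. datum (x, t) * \<phi> t)" .
qed

lemma in_Hst_L2x_datum: "in_Hst_L2x \<sigma> T datum"
  using is_Hs_extension_datum by (auto simp: in_Hst_L2x_def)

lemma Hst_L2x_norm_datum_le:
  "Hst_L2x_norm \<sigma> T datum \<le>
    sqrt ((LINT s|lborel. (cmod (wave e s))\<^sup>2) * (e * (17 * real N ^ 4) powr max \<sigma> 0))"
proof -
  have "Hst_L2x_norm \<sigma> T datum \<le> L2_norm_on UNIV (Hs_weighted \<sigma> datum_ext)"
    unfolding Hst_L2x_norm_def using is_Hs_extension_datum
    by (intro cInf_lower bdd_belowI[where m=0]) (auto simp: L2_norm_on_def set_lebesgue_integral_def)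
  then show ?thesis using datum_ext_L2(2) by (rule order_trans)
qed

end

section \<open>The modes of the solution\<close>

lemma
  fixes f :: "real \<Rightarrow> complex"
  assumes [measurable]: "f \<in> borel_measurable borel"
    and bound: "\<And>s. a \<le> s \<Longrightarrow> s \<le> b \<Longrightarrow> cmod (f s) \<le> B" and "a \<le> b"
  shows integrable_if_Icc: "integrable lborel (\<lambda>s. if a \<le> s \<and> s \<le> b then f s else 0)" (is "integrable _ ?f")
    and cmod_integral_if_Icc_le: "cmod (LINT s|lborel. (if a \<le> s \<and> s \<le> b then f s else 0)) \<le> B * (b - a)"
proof -
  show i: "integrable lborel ?f"
    by (rule integrableI_bounded_set[where A="{a..b}" and B=B]) (auto simp: bound emeasure_lborel_Icc_eq)
  have "cmod (integral\<^sup>L lborel ?f) \<le> (LINT s|lborel. cmod (?f s))"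
    by (rule integral_norm_bound)
  also have "\<dots> \<le> (LINT s|lborel. B * indicator {a..b} s)"
    using i bound by (intro integral_mono integrable_norm integrable_mult_right integrable_real_indicator)
      (auto simp: emeasure_lborel_Icc_eq indicator_def)
  also have "\<dots> = B * (b - a)" using \<open>a \<le> b\<close> by simp
  finally show "cmod (integral\<^sup>L lborel ?f) \<le> B * (b - a)" .
qed

lemma Re_integral_if_Icc_ge:
  fixes f :: "real \<Rightarrow> complex"
  assumes "integrable lborel (\<lambda>s. if a \<le> s \<and> s \<le> b then f s else 0)"
    and bound: "\<And>s. a \<le> s \<Longrightarrow> s \<le> b \<Longrightarrow> c \<le> Re (f s)" and "a \<le> b"
  shows "c * (b - a) \<le> Re (LINT s|lborel. (if a \<le> s \<and> s \<le> b then f s else 0))"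
proof -
  have "c * (b - a) = (LINT s|lborel. c * indicator {a..b} s)" using \<open>a \<le> b\<close> by simp
  also have "\<dots> \<le> Re (LINT s|lborel. (if a \<le> s \<and> s \<le> b then f s else 0))"
    using bound by (intro Re_integral_ge assms(1) integrable_mult_right integrable_real_indicator)
      (auto simp: emeasure_lborel_Icc_eq indicator_def)
  finally show ?thesis .
qed

context resonant_datum
begin

text \<open>In \<open>kern\<close>, \<open>duhamel\<close> and \<open>mode\<close> the parameter \<open>\<nu>\<close> stands for \<open>n\<^sup>2\<close>, which makes it plain that the
  modes \<open>n\<close> and \<open>-n\<close> are equal. On \<open>[0,1]\<close> the functions \<open>exp(i\<pi>ny)\<close> are not orthogonal, but by this
  symmetry only the sines, which are, contribute (\<open>sum_sin_coeff\<close>).\<close>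

definition kern :: "real \<Rightarrow> real \<Rightarrow> real \<Rightarrow> real \<Rightarrow> real \<Rightarrow> complex" where
  "kern \<nu> x t \<xi> \<tau> = exp (\<i> * of_real (pi * \<xi> * x - pi\<^sup>2 * (\<xi>\<^sup>2 + \<nu>) * (t - \<tau>) - pi\<^sup>2 * (real N)\<^sup>2 * \<tau>)) * wave e \<tau>"

definition duhamel :: "real \<Rightarrow> real \<Rightarrow> real \<Rightarrow> real \<Rightarrow> complex" where
  "duhamel \<nu> x t \<xi> = (LINT \<tau>|lborel. (if 0 \<le> \<tau> \<and> \<tau> \<le> t then kern \<nu> x t \<xi> \<tau> else 0))"

definition mode :: "real \<Rightarrow> real \<Rightarrow> real \<Rightarrow> complex" where
  "mode \<nu> x t = (LINT \<xi>|lborel. (if 0 \<le> \<xi> \<and> \<xi> \<le> e then duhamel \<nu> x t \<xi> else 0))"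

definition mode_sum :: "nat \<Rightarrow> real \<times> real \<times> real \<Rightarrow> complex" where
  "mode_sum K = (\<lambda>(x, y, t). \<Sum>n = - int K..int K.
     of_int n * exp (\<i> * of_real (pi * of_int n * y)) * mode ((of_int n)\<^sup>2) x t)"

lemma kern_measurable [measurable]:
  "(\<lambda>\<tau>. kern \<nu> x t \<xi> \<tau>) \<in> borel_measurable borel"
  unfolding kern_def by measurable

lemma duhamel_measurable [measurable]: "(\<lambda>\<xi>. duhamel \<nu> x t \<xi>) \<in> borel_measurable borel"
  unfolding duhamel_def kern_def by measurable

lemma mode_measurable_pair:
  "(\<lambda>p. mode \<nu> (fst p) (snd p)) \<in> borel_measurable (borel \<Otimes>\<^sub>M borel)"
  unfolding mode_def duhamel_def kern_def by measurable

lemma cmod_kern_le: "cmod (kern \<nu> x t \<xi> \<tau>) \<le> e"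
  using cmod_wave_le[of e \<tau>] e_pos unfolding kern_def norm_mult norm_exp_i_times by simp

lemma cmod_duhamel_le: "0 \<le> t \<Longrightarrow> cmod (duhamel \<nu> x t \<xi>) \<le> e * t"
  unfolding duhamel_def
  using cmod_integral_if_Icc_le[of "\<lambda>\<tau>. kern \<nu> x t \<xi> \<tau>" 0 t e] by (simp add: cmod_kern_le)

lemma mode_integrable: "0 \<le> t \<Longrightarrow> integrable lborel (\<lambda>\<xi>. if 0 \<le> \<xi> \<and> \<xi> \<le> e then duhamel \<nu> x t \<xi> else 0)"
  using e_pos by (intro integrable_if_Icc[where B="e * t"]) (auto simp: cmod_duhamel_le)

lemma cmod_mode_le: "0 \<le> t \<Longrightarrow> cmod (mode \<nu> x t) \<le> e * t * e"
  unfolding mode_def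
  using e_pos cmod_integral_if_Icc_le[of "\<lambda>\<xi>. duhamel \<nu> x t \<xi>" 0 e "e * t"] by (simp add: cmod_duhamel_le)

lemma cmod_mode_le_T: "0 \<le> t \<Longrightarrow> t \<le> T \<Longrightarrow> cmod (mode \<nu> x t) \<le> e * T * e"
  by (rule order_trans[OF cmod_mode_le]) (use e_pos in \<open>auto intro!: mult_mono\<close>)

text \<open>Once \<open>\<xi>\<close> avoids a null set, the chosen transform agrees with
  \<open>datum_hat\<close> for almost every \<open>\<tau>\<close> in \<open>{0..T}\<close>, and
  \<open>t \<le> T\<close> keeps the Duhamel integral in that range. The indicator in
  \<open>datum_hat\<close> then restricts \<open>\<xi>\<close> to \<open>[0,e]\<close>, and the
  finite sum is interchanged with the integral.\<close>

lemma Wb1_partial_datum: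
  assumes t: "0 \<le> t" "t \<le> T"
  shows "Wb1_partial T datum K (x, y, t) = mode_sum K (x, y, t)"
proof -
  \<comment> \<open>The transform is known to be measurable only on the strip, so it is cut off
    there before measurability of the Duhamel integrals in \<open>\<xi>\<close> is derived.\<close>
  define F where "F p = indicator (UNIV \<times> {0..T}) p *\<^sub>R fourier_x T datum p" for p
  define E where "E n \<xi> \<tau> = exp (- \<i> * of_real (pi\<^sup>2 * (\<xi>\<^sup>2 + (of_int n)\<^sup>2) * (t - \<tau>))
               + \<i> * of_real (pi * (\<xi> * x + of_int n * y)))" for n \<xi> \<tau>
  define J where "J H n \<xi> = (LINT \<tau>|lborel. (if 0 \<le> \<tau> \<and> \<tau> \<le> t then E n \<xi> \<tau> * H (\<xi>, \<tau>) else 0))"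
    for H :: "real \<times> real \<Rightarrow> complex" and n \<xi>
  have [measurable]: "F \<in> borel_measurable (lborel \<Otimes>\<^sub>M lborel)"
    using fourier_x_datum_measurable by (simp add: F_def[abs_def])
  have [measurable]: "datum_hat \<in> borel_measurable (lborel \<Otimes>\<^sub>M lborel)"
    unfolding lborel_prod by simp
  have J_measurable: "(\<lambda>\<xi>. J H n \<xi>) \<in> borel_measurable lborel"
    if [measurable]: "H \<in> borel_measurable (lborel \<Otimes>\<^sub>M lborel)" for H n
    unfolding J_def E_def by measurable
  have "Wb1_partial T datum K (x, y, t) = (LINT \<xi>|lborel. (\<Sum>n = - int K..int K. of_int n * J F n \<xi>))"
    unfolding Wb1_partial_def prod.case set_lebesgue_integral_def J_def E_def F_def
    using t by (intro Bochner_Integration.integral_cong sum.cong arg_cong2[where f="(*)"] refl)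
      (auto simp: indicator_def)
  also have "\<dots> = (LINT \<xi>|lborel. (\<Sum>n = - int K..int K. of_int n * J datum_hat n \<xi>))"
  proof (rule integral_cong_AE)
    show "AE \<xi> in lborel. (\<Sum>n = - int K..int K. of_int n * J F n \<xi>) =
        (\<Sum>n = - int K..int K. of_int n * J datum_hat n \<xi>)"
      using fourier_x_datum_AE
    proof eventually_elim
      case (elim \<xi>)
      have "J F n \<xi> = J datum_hat n \<xi>" for n
        unfolding J_def
      proof (rule integral_cong_AE)
        show "AE \<tau> in lborel. (if 0 \<le> \<tau> \<and> \<tau> \<le> t then E n \<xi> \<tau> * F (\<xi>, \<tau>) else 0) =
            (if 0 \<le> \<tau> \<and> \<tau> \<le> t then E n \<xi> \<tau> * datum_hat (\<xi>, \<tau>) else 0)"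
          using elim by eventually_elim (use t in \<open>auto simp: F_def\<close>)
      qed (unfold E_def, measurable)
      then show ?case by simp
    qed
  qed (intro borel_measurable_sum borel_measurable_times J_measurable; measurable)+
  also have "\<dots> = (LINT \<xi>|lborel. (\<Sum>n = - int K..int K. of_int n * exp (\<i> * of_real (pi * of_int n * y)) *
      (if 0 \<le> \<xi> \<and> \<xi> \<le> e then duhamel ((of_int n)\<^sup>2) x t \<xi> else 0)))"
  proof (intro Bochner_Integration.integral_cong sum.cong refl)
    fix \<xi> n
    have "J datum_hat n \<xi> = (LINT \<tau>|lborel. exp (\<i> * of_real (pi * of_int n * y)) * (indicator {0..e} \<xi> *
       (if 0 \<le> \<tau> \<and> \<tau> \<le> t then kern ((of_int n)\<^sup>2) x t \<xi> \<tau> else 0)))"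
      unfolding J_def E_def datum_hat_def kern_def
      by (intro Bochner_Integration.integral_cong) (auto simp: algebra_simps simp flip: exp_add)
    also have "\<dots> = exp (\<i> * of_real (pi * of_int n * y)) *
      (if 0 \<le> \<xi> \<and> \<xi> \<le> e then duhamel ((of_int n)\<^sup>2) x t \<xi> else 0)"
      unfolding duhamel_def integral_mult_right_zero by (simp add: indicator_def)
    finally show "of_int n * J datum_hat n \<xi> = of_int n * exp (\<i> * of_real (pi * of_int n * y)) *
      (if 0 \<le> \<xi> \<and> \<xi> \<le> e then duhamel ((of_int n)\<^sup>2) x t \<xi> else 0)"
      by simp
  qed
  also have "\<dots> = mode_sum K (x, y, t)"
    unfolding mode_sum_def mode_def prod.case integral_mult_right_zero[symmetric]
    by (intro Bochner_Integration.integral_sum integrable_mult_right mode_integrable t)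
  finally show ?thesis .
qed

section \<open>Lower bound for the resonant mode\<close>

text \<open>For \<open>\<nu> = N^2\<close> the phases \<open>pi^2 N^2 t\<close>,
  \<open>-pi^2 N^2 (t - \<tau>)\<close> and \<open>-pi^2 N^2 \<tau>\<close> cancel. What remains is
  a factor of small phase \<open>\<theta>\<close> times a nearly constant wave, and
  \<open>small\<close> keeps the product within \<open>e / 2\<close> of \<open>e\<close>.\<close>

lemma Re_kern_ge:
  assumes "0 \<le> x" "x \<le> e" "0 \<le> \<xi>" "\<xi> \<le> e" "0 \<le> \<tau>" "\<tau> \<le> t" "t \<le> T"
  shows "e / 2 \<le> Re (exp (\<i> * of_real (pi\<^sup>2 * (real N)\<^sup>2 * t)) * kern ((real N)\<^sup>2) x t \<xi> \<tau>)"
proof -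
  define \<theta> where "\<theta> = pi * \<xi> * x - pi\<^sup>2 * \<xi>\<^sup>2 * (t - \<tau>)"
  have eq: "exp (\<i> * of_real (pi\<^sup>2 * (real N)\<^sup>2 * t)) * kern ((real N)\<^sup>2) x t \<xi> \<tau> = iexp \<theta> * wave e \<tau>"
    unfolding kern_def \<theta>_def mult.assoc[symmetric] exp_add[symmetric] by (simp add: algebra_simps)
  have "\<bar>\<theta>\<bar> \<le> \<bar>pi * \<xi> * x\<bar> + \<bar>pi\<^sup>2 * \<xi>\<^sup>2 * (t - \<tau>)\<bar>"
    unfolding \<theta>_def by (rule abs_triangle_ineq4)
  also have "\<dots> = pi * (\<xi> * x) + pi\<^sup>2 * \<xi>\<^sup>2 * (t - \<tau>)"
    using assms by (simp add: abs_mult)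
  also have "\<dots> \<le> pi * (e * e) + pi\<^sup>2 * e\<^sup>2 * T"
    using assms by (intro add_mono mult_mono power_mono) auto
  finally have \<theta>: "\<bar>\<theta>\<bar> \<le> pi * e\<^sup>2 + pi\<^sup>2 * e\<^sup>2 * T" by (simp add: power2_eq_square)
  \<comment> \<open>The error is split into that of the wave and that of the phase factor, to be
    measured against the corresponding terms of \<open>small\<close>.\<close>
  have "cmod (iexp \<theta> * wave e \<tau> - of_real e) = cmod (iexp \<theta> * (wave e \<tau> - of_real e) + of_real e * (iexp \<theta> - 1))"
    by (simp add: algebra_simps)
  also have "\<dots> \<le> cmod (wave e \<tau> - of_real e) + e * cmod (iexp \<theta> - 1)"
    by (rule order_trans[OF norm_triangle_ineq]) (use e_pos in \<open>simp add: norm_mult\<close>)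
  also have "\<dots> \<le> e * (pi * e * \<bar>\<tau>\<bar>) + e * \<bar>\<theta>\<bar>"
    using e_pos by (intro add_mono mult_left_mono cmod_wave_diff_le norm_iexp_diff_one) auto
  also have "\<dots> \<le> e * (pi * e * T) + e * (pi * e\<^sup>2 + pi\<^sup>2 * e\<^sup>2 * T)"
    using e_pos assms by (intro add_mono mult_left_mono \<theta>) auto
  also have "\<dots> = e * (pi * e\<^sup>2 + pi\<^sup>2 * e\<^sup>2 * T + pi * e * T)" by (simp add: algebra_simps)
  also have "\<dots> \<le> e * (1 / 2)" using e_pos by (intro mult_left_mono small) auto
  finally have "cmod (iexp \<theta> * wave e \<tau> - of_real e) \<le> e / 2" by simp
  moreover have "\<bar>Re (iexp \<theta> * wave e \<tau> - of_real e)\<bar> \<le> cmod (iexp \<theta> * wave e \<tau> - of_real e)"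
    by (rule abs_Re_le_cmod)
  ultimately show ?thesis unfolding eq by simp
qed

text \<open>A lower bound for the real part, unlike one for the modulus, survives integration; the
  intervals of \<open>\<tau>\<close> and \<open>\<xi>\<close> contribute their lengths
  \<open>t\<close> and \<open>e\<close>.\<close>

lemma Re_mode_ge:
  assumes "0 \<le> x" "x \<le> e" "0 \<le> t" "t \<le> T"
  shows "e\<^sup>2 / 2 * t \<le> Re (exp (\<i> * of_real (pi\<^sup>2 * (real N)\<^sup>2 * t)) * mode ((real N)\<^sup>2) x t)"
proof -
  let ?z = "exp (\<i> * of_real (pi\<^sup>2 * (real N)\<^sup>2 * t))"
  have d: "e / 2 * (t - 0) \<le> Re (?z * duhamel ((real N)\<^sup>2) x t \<xi>)" if "0 \<le> \<xi>" "\<xi> \<le> e" for \<xi>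
  proof -
    have "?z * duhamel ((real N)\<^sup>2) x t \<xi> = (LINT \<tau>|lborel. (if 0 \<le> \<tau> \<and> \<tau> \<le> t then ?z * kern ((real N)\<^sup>2) x t \<xi> \<tau> else 0))"
      unfolding duhamel_def integral_mult_right_zero[symmetric] if_distrib[of "(*) ?z"] by (simp cong: if_cong)
    also have "e / 2 * (t - 0) \<le> Re \<dots>"
      using assms that Re_kern_ge
      by (intro Re_integral_if_Icc_ge integrable_if_Icc[where B=e]) (auto simp: norm_mult cmod_kern_le)
    finally show ?thesis .
  qed
  have "?z * mode ((real N)\<^sup>2) x t = (LINT \<xi>|lborel. (if 0 \<le> \<xi> \<and> \<xi> \<le> e then ?z * duhamel ((real N)\<^sup>2) x t \<xi> else 0))"
    unfolding mode_def integral_mult_right_zero[symmetric] if_distrib[of "(*) ?z"] by (simp cong: if_cong)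
  also have "e / 2 * (t - 0) * (e - 0) \<le> Re \<dots>"
    using assms d e_pos
    by (intro Re_integral_if_Icc_ge integrable_if_Icc[where B="e * t"]) (auto simp: norm_mult cmod_duhamel_le)
  finally show ?thesis by (simp add: power2_eq_square algebra_simps)
qed

text \<open>The \<open>x\<close> and \<open>t\<close> part of the pairing of one mode with
  \<open>resonance\<close>; the exponential undoes the modulation of the datum.\<close>

definition pairing :: "real \<Rightarrow> complex" where
  "pairing \<nu> = (LINT x|lborel. (if 0 \<le> x \<and> x \<le> e then
     (LINT t|lborel. (if 0 \<le> t \<and> t \<le> T then exp (\<i> * of_real (pi\<^sup>2 * (real N)\<^sup>2 * t)) * mode \<nu> x t else 0)) else 0))"

lemma pairing_inner_integrable:
  "integrable lborel (\<lambda>t. if 0 \<le> t \<and> t \<le> T then exp (\<i> * of_real (pi\<^sup>2 * (real N)\<^sup>2 * t)) * mode \<nu> x t else 0)"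
proof (rule integrable_if_Icc[where B="e * T * e"])
  show "(\<lambda>t. exp (\<i> * of_real (pi\<^sup>2 * (real N)\<^sup>2 * t)) * mode \<nu> x t) \<in> borel_measurable borel"
    unfolding mode_def duhamel_def kern_def by measurable
qed (use T_pos in \<open>auto simp: norm_mult cmod_mode_le_T\<close>)

lemma Re_pairing_ge: "e ^ 3 * T\<^sup>2 / 4 \<le> Re (pairing ((real N)\<^sup>2))"
proof -
  let ?f = "\<lambda>x t. if 0 \<le> t \<and> t \<le> T then exp (\<i> * of_real (pi\<^sup>2 * (real N)\<^sup>2 * t)) * mode ((real N)\<^sup>2) x t else 0"
  have lower: "e\<^sup>2 * T\<^sup>2 / 4 \<le> Re (LINT t|lborel. ?f x t)" if "0 \<le> x" "x \<le> e" for x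
  proof -
    have "e\<^sup>2 * T\<^sup>2 / 4 = (LINT t|lborel. e\<^sup>2 / 2 * (t ^ 1 * indicator {0..T} t))"
      unfolding integral_mult_right_zero using T_pos by (subst integral_power) (auto simp: power2_eq_square)
    also have "\<dots> \<le> Re (LINT t|lborel. ?f x t)"
    proof (intro Re_integral_ge pairing_inner_integrable integrable_mult_right)
      show "integrable lborel (\<lambda>t::real. t ^ 1 * indicator {0..T} t)"
        using borel_integrable_atLeastAtMost'[of 0 T "\<lambda>t. t"] by (simp add: set_integrable_def mult.commute)
      show "e\<^sup>2 / 2 * (t ^ 1 * indicator {0..T} t) \<le> Re (?f x t)" for t
        using Re_mode_ge[of x t] that by (auto simp: indicator_def)
    qed
    finally show ?thesis .
  qed
  have "e\<^sup>2 * T\<^sup>2 / 4 * (e - 0) \<le> Re (pairing ((real N)\<^sup>2))"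
    unfolding pairing_def
  proof (intro Re_integral_if_Icc_ge lower integrable_if_Icc[where B="e * T * e * (T - 0)"])
    show "(\<lambda>x. LINT t|lborel. ?f x t) \<in> borel_measurable borel"
      unfolding mode_def duhamel_def kern_def by measurable
    show "cmod (LINT t|lborel. ?f x t) \<le> e * T * e * (T - 0)" for x
    proof (rule cmod_integral_if_Icc_le)
      show "(\<lambda>t. exp (\<i> * of_real (pi\<^sup>2 * (real N)\<^sup>2 * t)) * mode ((real N)\<^sup>2) x t) \<in> borel_measurable borel"
        unfolding mode_def duhamel_def kern_def by measurable
    qed (use T_pos in \<open>auto simp: norm_mult cmod_mode_le_T\<close>)
  qed (use e_pos in auto)
  then show ?thesis by (simp add: power3_eq_cube power2_eq_square mult_ac)
qed

subsection \<open>Testing against the resonant mode\<close>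

definition box :: "(real \<times> real \<times> real) set" where
  "box = {0..e} \<times> {0..1} \<times> {0..T}"

lemma compact_box: "compact box"
  unfolding box_def by (intro compact_Times compact_Icc)

lemma box_sets [measurable]: "box \<in> sets borel"
  using compact_box by (rule borel_compact)

lemma emeasure_box: "emeasure lborel box < \<infinity>"
  using compact_box by (rule emeasure_compact_finite)

lemma strip3_sets [measurable]: "UNIV \<times> {0..1} \<times> {0..T} \<in> sets (borel :: (real \<times> real \<times> real) measure)"
  by (intro borel_closed closed_Times) auto

text \<open>The pairing is bilinear, without complex conjugation, so the time factor carries the
  sign opposite to that of the modulation of the datum.\<close>

definition resonance :: "real \<times> real \<times> real \<Rightarrow> complex" where
  "resonance = (\<lambda>(x, y, t). indicator box (x, y, t) *
     (of_real (sin (pi * real N * y)) * exp (\<i> * of_real (pi\<^sup>2 * (real N)\<^sup>2 * t))))"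

definition mode_term :: "int \<Rightarrow> real \<times> real \<times> real \<Rightarrow> complex" where
  "mode_term n = (\<lambda>(x, y, t). exp (\<i> * of_real (pi * of_int n * y)) * mode ((of_int n)\<^sup>2) x t)"

lemma mode_term_measurable [measurable]: "mode_term n \<in> borel_measurable borel"
proof -
  have "(\<lambda>p. (fst p, snd (snd p))) \<in> (borel \<Otimes>\<^sub>M (borel \<Otimes>\<^sub>M borel)) \<rightarrow>\<^sub>M (borel \<Otimes>\<^sub>M borel :: (real \<times> real) measure)"
    by measurable
  from measurable_compose[OF this mode_measurable_pair[of "(of_int n)\<^sup>2"]]
  have [measurable]: "(\<lambda>p. mode ((of_int n)\<^sup>2) (fst p) (snd (snd p))) \<in>
      borel_measurable (borel \<Otimes>\<^sub>M (borel \<Otimes>\<^sub>M borel :: (real \<times> real) measure))"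
    by simp
  have "(\<lambda>p. exp (\<i> * of_real (pi * of_int n * fst (snd p))) * mode ((of_int n)\<^sup>2) (fst p) (snd (snd p))) \<in>
      borel_measurable (borel \<Otimes>\<^sub>M (borel \<Otimes>\<^sub>M borel :: (real \<times> real) measure))"
    by measurable
  then show ?thesis
    by (simp add: mode_term_def case_prod_unfold borel_prod)
qed

lemma resonance_measurable [measurable]: "resonance \<in> borel_measurable borel"
proof -
  have "(\<lambda>p. of_real (sin (pi * real N * fst (snd p))) * exp (\<i> * of_real (pi\<^sup>2 * (real N)\<^sup>2 * snd (snd p)))) \<in>
      borel_measurable (borel \<Otimes>\<^sub>M (borel \<Otimes>\<^sub>M borel :: (real \<times> real) measure))"
    by measurable
  then have [measurable]: "(\<lambda>p. of_real (sin (pi * real N * fst (snd p))) * exp (\<i> * of_real (pi\<^sup>2 * (real N)\<^sup>2 * snd (snd p)))) \<in>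
      borel_measurable (borel :: (real \<times> real \<times> real) measure)"
    by (simp add: borel_prod)
  have "(\<lambda>p. indicator box p * (of_real (sin (pi * real N * fst (snd p))) * exp (\<i> * of_real (pi\<^sup>2 * (real N)\<^sup>2 * snd (snd p))))) \<in>
      borel_measurable borel"
    by (rule borel_measurable_times) measurable
  then show ?thesis
    by (simp add: resonance_def case_prod_unfold)
qed

lemma cmod_resonance_le: "cmod (resonance p) \<le> indicator box p"
  by (auto simp: resonance_def norm_mult indicator_def split: prod.splits)

lemma cmod_mode_term_le: "p \<in> box \<Longrightarrow> cmod (mode_term n p) \<le> e * T * e"
  by (auto simp: mode_term_def norm_mult box_def cmod_mode_le_T)

lemma mode_sum_eq: "mode_sum K p = (\<Sum>n = - int K..int K. of_int n * mode_term n p)"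
  by (auto simp: mode_sum_def mode_term_def mult.assoc split: prod.splits)

lemma mode_sum_measurable [measurable]: "mode_sum K \<in> borel_measurable borel"
  unfolding mode_sum_eq[abs_def] by measurable

lemma mode_term_integrable: "integrable lborel (\<lambda>p. resonance p * mode_term n p)"
proof (rule integrableI_bounded_set[where A=box and B="e * T * e"])
  show "AE p in lborel. p \<in> box \<longrightarrow> cmod (resonance p * mode_term n p) \<le> e * T * e"
  proof (intro AE_I2 impI)
    fix p assume p: "p \<in> box"
    have "cmod (resonance p * mode_term n p) \<le> 1 * (e * T * e)"
      unfolding norm_mult using cmod_resonance_le[of p] cmod_mode_term_le[OF p] p
      by (intro mult_mono) auto
    then show "cmod (resonance p * mode_term n p) \<le> e * T * e" by simp
  qed
  show "AE p in lborel. p \<notin> box \<longrightarrow> resonance p * mode_term n p = 0"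
    by (auto simp: resonance_def)
qed (use emeasure_box in auto)

text \<open>On the box the integrand is a function of \<open>y\<close> times a function of
  \<open>(x,t)\<close>, so Fubini separates the \<open>y\<close> integral, which is
  \<open>sin_coeff\<close>.\<close>

lemma integral_mode_term:
  "(LINT p|lborel. resonance p * mode_term n p) = sin_coeff (int N) n * pairing ((of_int n)\<^sup>2)"
proof -
  interpret triple: pair_sigma_finite lborel "lborel \<Otimes>\<^sub>M lborel :: (real \<times> real) measure"
    unfolding lborel_prod ..
  define a where "a y = indicator {0..1} y *\<^sub>R
    (exp (\<i> * of_real (pi * of_int n * y)) * of_real (sin (pi * of_int (int N) * y)))" for y :: real
  define b where "b x t = (if 0 \<le> t \<and> t \<le> T then exp (\<i> * of_real (pi\<^sup>2 * (real N)\<^sup>2 * t)) * mode ((of_int n)\<^sup>2) x t else 0)" for x t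
  have ia: "integrable lborel a"
    unfolding a_def set_integrable_def[symmetric]
    by (intro borel_integrable_atLeastAtMost' continuous_intros)
  have ib: "integrable lborel (b x)" for x
    unfolding b_def by (rule pairing_inner_integrable)
  have prod_eq: "resonance (x, p) * mode_term n (x, p) =
      (if 0 \<le> x \<and> x \<le> e then (case p of (y, t) \<Rightarrow> a y * b x t) else 0)" for x p
    by (cases p) (auto simp: resonance_def mode_term_def a_def b_def box_def indicator_def)
  have "(LINT p|lborel. resonance p * mode_term n p) =
      (LINT x|lborel. (LINT p|(lborel \<Otimes>\<^sub>M lborel). resonance (x, p) * mode_term n (x, p)))"
    using triple.integral_fst'[of "\<lambda>p. resonance p * mode_term n p"] mode_term_integrable
    by (simp add: lborel_prod)
  also have "\<dots> = (LINT x|lborel. integral\<^sup>L lborel a * (if 0 \<le> x \<and> x \<le> e then integral\<^sup>L lborel (b x) else 0))"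
  proof (intro Bochner_Integration.integral_cong refl)
    fix x
    show "(LINT p|(lborel \<Otimes>\<^sub>M lborel). resonance (x, p) * mode_term n (x, p)) =
        integral\<^sup>L lborel a * (if 0 \<le> x \<and> x \<le> e then integral\<^sup>L lborel (b x) else 0)"
      unfolding prod_eq using lborel_pair.integral_prod_mult[OF ia ib[of x]]
      by (cases "0 \<le> x \<and> x \<le> e") auto
  qed
  also have "\<dots> = sin_coeff (int N) n * pairing ((of_int n)\<^sup>2)"
    unfolding integral_mult_right_zero
    unfolding sin_coeff_def a_def b_def pairing_def set_lebesgue_integral_def by simp
  finally show ?thesis .
qed

text \<open>\<open>pairing\<close> sees \<open>n\<close> only through \<open>n^2\<close> and so is
  even in \<open>n\<close>, which lets \<open>sum_sin_coeff\<close> isolate the resonant modes. The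
  hypothesis \<open>N \<le> K\<close> ensures that both \<open>N\<close> and \<open>-N\<close> occur
  in the partial sum.\<close>

lemma integral_mode_sum:
  assumes "N \<le> K"
  shows "(LINT p|lborel. resonance p * mode_sum K p) = \<i> * of_nat N * pairing ((real N)\<^sup>2)"
proof -
  have "(LINT p|lborel. resonance p * mode_sum K p) =
      (LINT p|lborel. (\<Sum>n = - int K..int K. of_int n * (resonance p * mode_term n p)))"
    by (simp add: mode_sum_eq sum_distrib_left mult.left_commute)
  also have "\<dots> = (\<Sum>n = - int K..int K. of_int n * (sin_coeff (int N) n * pairing ((of_int n)\<^sup>2)))"
    by (subst Bochner_Integration.integral_sum)
      (auto intro!: integrable_mult_right mode_term_integrable simp: integral_mode_term)
  also have "\<dots> = \<i> * of_int (int N) * pairing ((of_int (int N))\<^sup>2)"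
    unfolding mult.assoc[symmetric] using assms N_pos by (intro sum_sin_coeff) auto
  finally show ?thesis by simp
qed

text \<open>Cauchy-Schwarz with \<open>resonance\<close>, whose modulus is at most the indicator of
  the box, turns the size of the pairing into an \<open>L^2\<close> lower bound that is uniform in
  \<open>K\<close>.\<close>

lemma mode_sum_lower_bound:
  assumes "N \<le> K"
  shows "ennreal ((real N * (e ^ 3 * T\<^sup>2 / 4))\<^sup>2) \<le>
    emeasure lborel box * (\<integral>\<^sup>+p. indicator box p * ennreal ((cmod (mode_sum K p))\<^sup>2) \<partial>lborel)"
proof -
  have "real N * (e ^ 3 * T\<^sup>2 / 4) \<le> real N * cmod (pairing ((real N)\<^sup>2))"
    by (intro mult_left_mono order_trans[OF Re_pairing_ge complex_Re_le_cmod]) auto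
  also have "\<dots> = cmod (LINT p|lborel. resonance p * mode_sum K p)"
    by (simp add: integral_mode_sum[OF assms] norm_mult)
  finally have "ennreal (real N * (e ^ 3 * T\<^sup>2 / 4)) \<le> ennreal (cmod (LINT p|lborel. resonance p * mode_sum K p))"
    by (rule ennreal_leI)
  also have "\<dots> \<le> (\<integral>\<^sup>+p. ennreal (cmod (resonance p * mode_sum K p)) \<partial>lborel)"
  proof (rule integral_norm_bound_ennreal)
    show "integrable lborel (\<lambda>p. resonance p * mode_sum K p)"
      unfolding mode_sum_eq sum_distrib_left mult.left_commute[of "resonance _"]
      by (intro Bochner_Integration.integrable_sum integrable_mult_right mode_term_integrable)
  qed
  \<comment> \<open>The indicator equals its square, so it is written twice: one copy is a factor
    for Cauchy-Schwarz, the other confines the partial sum to the box.\<close>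
  also have "\<dots> \<le> (\<integral>\<^sup>+p. indicator box p * (indicator box p * ennreal (cmod (mode_sum K p))) \<partial>lborel)"
  proof (rule nn_integral_mono)
    fix p
    show "ennreal (cmod (resonance p * mode_sum K p)) \<le>
        indicator box p * (indicator box p * ennreal (cmod (mode_sum K p)))"
      using mult_right_mono[OF cmod_resonance_le[of p], of "cmod (mode_sum K p)"] cmod_resonance_le[of p]
      by (auto simp: norm_mult indicator_def ennreal_leI split: if_splits)
  qed
  finally have "(ennreal (real N * (e ^ 3 * T\<^sup>2 / 4)))\<^sup>2 \<le>
      (\<integral>\<^sup>+p. indicator box p * (indicator box p * ennreal (cmod (mode_sum K p))) \<partial>lborel)\<^sup>2"
    by (intro power_mono) auto
  also have "\<dots> \<le> (\<integral>\<^sup>+p. (indicator box p)\<^sup>2 \<partial>lborel) *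
      (\<integral>\<^sup>+p. (indicator box p * ennreal (cmod (mode_sum K p)))\<^sup>2 \<partial>lborel)"
    by (rule Cauchy_Schwarz_nn_integral) measurable
  also have "(\<integral>\<^sup>+p. (indicator box p)\<^sup>2 \<partial>lborel) = emeasure lborel box"
  proof -
    have "(indicator box p)\<^sup>2 = (indicator box p :: ennreal)" for p by (simp add: indicator_def)
    then show ?thesis by simp
  qed
  also have "(\<integral>\<^sup>+p. (indicator box p * ennreal (cmod (mode_sum K p)))\<^sup>2 \<partial>lborel) =
      (\<integral>\<^sup>+p. indicator box p * ennreal ((cmod (mode_sum K p))\<^sup>2) \<partial>lborel)"
    by (intro nn_integral_cong) (auto simp: indicator_def ennreal_power)
  finally show ?thesis
    using e_pos by (simp add: ennreal_power)
qed

lemma box_subset: "box \<subseteq> UNIV \<times> {0..1} \<times> {0..T}"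
  by (auto simp: box_def)

text \<open>The uniform bound is combined with \<open>|S|^2 \<le> 2|u|^2 + 2|S - u|^2\<close> for
  the partial sums \<open>S\<close>. The integral of the last term tends to 0, which leaves a bound
  on the limit \<open>u\<close>.\<close>

lemma Wb1_lower_bound:
  assumes u: "is_Wb1 T datum u"
  shows "(real N * (e ^ 3 * T\<^sup>2 / 4))\<^sup>2 \<le>
    measure lborel box * (2 * (L2_norm_on (UNIV \<times> {0..1} \<times> {0..T}) u)\<^sup>2)"
proof -
  let ?A = "UNIV \<times> {0..1} \<times> {0..T} :: (real \<times> real \<times> real) set"
  let ?V = "emeasure lborel box"
  \<comment> \<open>\<open>u\<close> is only assumed measurable on the strip, so its extension by
    zero is used.\<close>
  define w where "w p = indicator ?A p *\<^sub>R u p" for p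
  have [measurable]: "w \<in> borel_measurable borel"
    using u by (simp add: is_Wb1_def L2_on_def set_borel_measurable_def w_def[abs_def])
  have int: "integrable lborel (\<lambda>p. (cmod (w p))\<^sup>2)"
  proof -
    have "(\<lambda>p. indicator ?A p *\<^sub>R (cmod (u p))\<^sup>2) = (\<lambda>p. (cmod (w p))\<^sup>2)"
      by (auto simp: w_def indicator_def)
    then show ?thesis
      using u by (simp add: is_Wb1_def L2_on_def set_integrable_def)
  qed
  define U where "U = (\<integral>\<^sup>+p. ennreal ((cmod (w p))\<^sup>2) \<partial>lborel)"
  have U: "U = ennreal ((L2_norm_on ?A u)\<^sup>2)"
  proof -
    have "(L2_norm_on ?A u)\<^sup>2 = (LINT p|lborel. (cmod (w p))\<^sup>2)"
      unfolding L2_norm_on_def set_lebesgue_integral_def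
      by (subst real_sqrt_pow2)
        (auto intro!: Bochner_Integration.integral_cong Bochner_Integration.integral_nonneg simp: w_def indicator_def)
    then show ?thesis unfolding U_def using int by (simp add: nn_integral_eq_integral)
  qed
  define d where "d K = (\<integral>\<^sup>+p\<in>?A. ennreal ((cmod (Wb1_partial T datum K p - u p))\<^sup>2) \<partial>lborel)" for K
  have d: "d \<longlonglongrightarrow> 0"
    using u by (simp add: is_Wb1_def L2_tendsto_on_def d_def[abs_def])
  have d_eq: "d K = (\<integral>\<^sup>+p. indicator ?A p * ennreal ((cmod (mode_sum K p - w p))\<^sup>2) \<partial>lborel)" for K
    unfolding d_def
    by (intro nn_integral_cong) (auto simp: w_def indicator_def Wb1_partial_datum)
  have "ennreal ((real N * (e ^ 3 * T\<^sup>2 / 4))\<^sup>2) \<le> ?V * (2 * U + 2 * d K)" if "N \<le> K" for K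
  proof -
    have "(\<integral>\<^sup>+p. indicator box p * ennreal ((cmod (mode_sum K p))\<^sup>2) \<partial>lborel) \<le>
        (\<integral>\<^sup>+p. 2 * ennreal ((cmod (w p))\<^sup>2) + 2 * (indicator ?A p * ennreal ((cmod (mode_sum K p - w p))\<^sup>2)) \<partial>lborel)"
    proof (rule nn_integral_mono)
      fix p
      show "indicator box p * ennreal ((cmod (mode_sum K p))\<^sup>2) \<le>
          2 * ennreal ((cmod (w p))\<^sup>2) + 2 * (indicator ?A p * ennreal ((cmod (mode_sum K p - w p))\<^sup>2))"
      proof (cases "p \<in> box")
        case True
        have "cmod (mode_sum K p) \<le> cmod (w p) + cmod (mode_sum K p - w p)"
          by (rule norm_triangle_sub)
        then have "(cmod (mode_sum K p))\<^sup>2 \<le> (cmod (w p) + cmod (mode_sum K p - w p))\<^sup>2"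
          by (intro power_mono) auto
        also have "\<dots> \<le> 2 * (cmod (w p))\<^sup>2 + 2 * (cmod (mode_sum K p - w p))\<^sup>2"
          using sum_squares_bound[of "cmod (w p)" "cmod (mode_sum K p - w p)"]
          by (simp add: power2_sum)
        finally have "ennreal ((cmod (mode_sum K p))\<^sup>2) \<le>
            ennreal (2 * (cmod (w p))\<^sup>2 + 2 * (cmod (mode_sum K p - w p))\<^sup>2)"
          by (rule ennreal_leI)
        then show ?thesis
          using True box_subset by (auto simp: ennreal_mult ennreal_plus)
      qed simp
    qed
    also have "\<dots> = 2 * U + 2 * d K"
      unfolding U_def d_eq by (subst nn_integral_add) (auto simp: nn_integral_cmult)
    finally show ?thesis
      using mode_sum_lower_bound[OF that] by (meson mult_left_mono order_trans zero_le)
  qed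
  then have ev: "\<forall>\<^sub>F K in sequentially. ennreal ((real N * (e ^ 3 * T\<^sup>2 / 4))\<^sup>2) \<le> ?V * (2 * U + 2 * d K)"
    unfolding eventually_sequentially by blast
  \<comment> \<open>The volume of the box is finite, so multiplication by it is continuous on
    \<open>[0,\<infinity>]\<close>.\<close>
  have "(\<lambda>K. ?V * (2 * U + 2 * d K)) \<longlonglongrightarrow> ?V * (2 * U + 2 * 0)"
    using emeasure_box by (intro ennreal_tendsto_cmult tendsto_add tendsto_const d) auto
  from tendsto_lowerbound[OF this ev]
  have "ennreal ((real N * (e ^ 3 * T\<^sup>2 / 4))\<^sup>2) \<le> ?V * (2 * U)" by simp
  also have "\<dots> = ennreal (measure lborel box * (2 * (L2_norm_on ?A u)\<^sup>2))"
    using emeasure_box by (simp add: U emeasure_eq_ennreal_measure ennreal_mult)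
  finally show ?thesis
    by (subst (asm) ennreal_le_iff) auto
qed

end

section \<open>Comparison of growth rates and conclusion\<close>

text \<open>After division by \<open>N\<close> the right side is a multiple of
  \<open>N powr (2 * s - 1)\<close> plus \<open>\<beta> / N\<close>, which tends to 0 if
  \<open>s < 1 / 2\<close>, while the left side stays at \<open>c\<close>.\<close>

lemma power_growth_exponent:
  fixes c \<alpha> \<beta> a s :: real
  assumes "c > 0" "a \<ge> 0"
    and bound: "\<And>N::nat. 0 < N \<Longrightarrow> c * real N \<le> \<alpha> * sqrt (a * (17 * real N ^ 4) powr s) + \<beta>"
  shows "1 / 2 \<le> s"
proof (rule ccontr)
  assume "\<not> 1 / 2 \<le> s"
  then have s: "2 * s - 1 < 0" by simp
  define f where "f N = \<alpha> * sqrt (a * 17 powr s) * real N powr (2 * s - 1) + \<beta> / real N" for N :: nat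
  have "f \<longlonglongrightarrow> \<alpha> * sqrt (a * 17 powr s) * 0 + 0"
    unfolding f_def
    by (intro tendsto_add tendsto_mult tendsto_const tendsto_neg_powr[OF s] filterlim_real_sequentially
        lim_const_over_n)
  moreover have "c \<le> f N" if "0 < N" for N
  proof -
    have N: "0 < real N" using that by simp
    have "sqrt ((real N ^ 4) powr s) = real N powr (2 * s)"
    proof -
      have "(real N ^ 4) powr s = (real N powr (2 * s))\<^sup>2"
      proof -
        have "real N ^ 4 = real N powr 4"
          using powr_realpow[OF N, of 4] by simp
        then have "(real N ^ 4) powr s = real N powr (2 * s + 2 * s)"
          by (simp only: powr_powr) simp
        then show ?thesis
          by (simp only: powr_add power2_eq_square)
      qed
      then show ?thesis by simp
    qed
    then have "sqrt (a * (17 * real N ^ 4) powr s) = sqrt (a * 17 powr s) * real N powr (2 * s)"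
      by (simp add: powr_mult real_sqrt_mult)
    then have "c * real N \<le> \<alpha> * (sqrt (a * 17 powr s) * real N powr (2 * s)) + \<beta>"
      using bound[OF that] by simp
    also have "real N powr (2 * s) = real N powr (2 * s - 1) * real N"
      using N by (simp add: powr_diff)
    finally show ?thesis using N by (simp add: f_def field_simps)
  qed
  then have "\<forall>\<^sub>F N in sequentially. c \<le> f N"
    unfolding eventually_sequentially by (meson less_le_trans zero_less_one)
  ultimately have "c \<le> \<alpha> * sqrt (a * 17 powr s) * 0 + 0"
    by (rule tendsto_lowerbound) simp
  with \<open>c > 0\<close> show False by simp
qed

theorem proposition3p5:
  fixes T \<sigma> :: real
  assumes "T > 0"
    and "\<exists>C>0. \<forall>h :: real \<times> real \<Rightarrow> complex.
           in_Hst_L2x \<sigma> T h \<and> in_L2t_H1x T h \<longrightarrow>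
           (\<exists>u. is_Wb1 T h u \<and>
                L2_norm_on (UNIV \<times> {0..1} \<times> {0..T}) u
                  \<le> C * (Hst_L2x_norm \<sigma> T h + L2t_H1x_norm T h))"
  shows "\<sigma> \<ge> 1 / 2"
proof -
  obtain C where C: "C > 0" and est: "\<And>h. in_Hst_L2x \<sigma> T h \<Longrightarrow> in_L2t_H1x T h \<Longrightarrow>
      \<exists>u. is_Wb1 T h u \<and> L2_norm_on (UNIV \<times> {0..1} \<times> {0..T}) u \<le> C * (Hst_L2x_norm \<sigma> T h + L2t_H1x_norm T h)"
    using assms(2) by blast
  \<comment> \<open>By \<open>pi < 4\<close> and \<open>e^2 \<le> e\<close> the left side of
    \<open>small\<close> is at most \<open>24 e (1 + T)\<close>, which this choice makes equal to
    1/2.\<close>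
  define e where "e = 1 / (48 * (1 + T))"
  have e_pos: "0 < e" and e1: "e \<le> 1" and eT: "e * (1 + T) = 1 / 48"
    using assms(1) by (auto simp: e_def)
  have small: "pi * e\<^sup>2 + pi\<^sup>2 * e\<^sup>2 * T + pi * e * T \<le> 1 / 2"
  proof -
    have "e\<^sup>2 \<le> e" using e_pos e1 by (simp add: power2_eq_square mult_left_le)
    moreover have "pi\<^sup>2 \<le> 4\<^sup>2" using pi_less_4 by (intro power_mono) auto
    ultimately have "pi * e\<^sup>2 + pi\<^sup>2 * e\<^sup>2 * T + pi * e * T \<le> 4 * e + 4\<^sup>2 * e * T + 4 * e * T"
      using pi_less_4 e_pos assms(1) by (intro add_mono mult_mono) auto
    also have "\<dots> \<le> 24 * (e * (1 + T))"
      using e_pos assms(1) by (simp add: algebra_simps)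
    finally show ?thesis using eT by simp
  qed
  define A where "A = (LINT s|lborel. (cmod (wave e s))\<^sup>2)"
  define B where "B = sqrt (LINT p|lborel. (1 + e\<^sup>2) * e\<^sup>2 * indicator ({0..e} \<times> {0..T}) p)"
  define V where "V = measure lborel ({0..e} \<times> {0..1::real} \<times> {0..T})"
  \<comment> \<open>The constants \<open>A\<close>, \<open>B\<close>, \<open>C\<close> and
    \<open>V\<close> do not depend on \<open>N\<close>; the lower bound is linear in
    \<open>N\<close>, and the assumed estimate bounds it by the norms of the datum.\<close>
  have "e ^ 3 * T\<^sup>2 / 4 * real N \<le>
      sqrt (2 * V) * C * sqrt (A * e * (17 * real N ^ 4) powr max \<sigma> 0) + sqrt (2 * V) * C * B"
    if "0 < N" for N :: nat
  proof -
    interpret resonant_datum T e N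
      by unfold_locales (use assms(1) e_pos e1 that small in auto)
    obtain u where u: "is_Wb1 T datum u"
      and u_le: "L2_norm_on (UNIV \<times> {0..1} \<times> {0..T}) u \<le> C * (Hst_L2x_norm \<sigma> T datum + L2t_H1x_norm T datum)"
      using est[OF in_Hst_L2x_datum in_L2t_H1x_datum] by blast
    let ?U = "L2_norm_on (UNIV \<times> {0..1} \<times> {0..T}) u"
    have U0: "0 \<le> ?U" by (simp add: L2_norm_on_def set_lebesgue_integral_def)
    have "(e ^ 3 * T\<^sup>2 / 4 * real N)\<^sup>2 \<le> 2 * V * ?U\<^sup>2"
      using Wb1_lower_bound[OF u] by (simp add: V_def box_def mult_ac)
    then have "e ^ 3 * T\<^sup>2 / 4 * real N \<le> sqrt (2 * V * ?U\<^sup>2)"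
      by (rule real_le_rsqrt)
    also have "\<dots> = sqrt (2 * V) * ?U"
      using U0 by (simp add: real_sqrt_mult)
    also have "\<dots> \<le> sqrt (2 * V) * (C * (sqrt (A * (e * (17 * real N ^ 4) powr max \<sigma> 0)) + B))"
      using C Hst_L2x_norm_datum_le[of \<sigma>] L2t_H1x_norm_datum_le unfolding A_def B_def
      by (intro mult_left_mono order_trans[OF u_le] add_mono) (auto simp: V_def)
    finally show ?thesis by (simp add: algebra_simps)
  qed
  moreover have "e ^ 3 * T\<^sup>2 / 4 > 0" using e_pos assms(1) by simp
  moreover have "A * e \<ge> 0" using e_pos by (simp add: A_def)
  \<comment> \<open>The growth comparison bounds \<open>max \<sigma> 0\<close>; since 0 is less than
    1/2, the maximum must be \<open>\<sigma>\<close>.\<close>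
  ultimately have "1 / 2 \<le> max \<sigma> 0"
    by (intro power_growth_exponent[where c="e ^ 3 * T\<^sup>2 / 4" and \<alpha>="sqrt (2 * V) * C" and a="A * e"]) auto
  then show ?thesis by simp
qed

end
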